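(* Let $X,V$ be complex Hilbert spaces, let $A_0$ be the generator of a unitary group $(T_0(t))_{t\in\mathbb{R}}$ on $X$, let $B\in L^2_{\mathrm{loc}}(\mathbb{R}_+;\mathcal{B}(V,X))$, and let $A(t)=A_0-B(t)B(t)^*$, $D(A(t))=D(A_0)$, $t\ge0$, with associated evolution family of contractions $(U(t,s))_{t\ge s\ge0}$. Suppose that $B$ is $\tau$-periodic for some $\tau>0$ and that $T_0(\tau)=I$, and let $T=U(\tau,0)$ be the monodromy operator. Let $P$ denote the orthogonal projection onto the closed subspace $$Y=\left\{x\in X:\int_0^\tau\|B(t)^*T_0(t)x\|^2\,dt=0\right\}$$ of $X$ and let $Z=Y^\perp$. For $x\in X$ let $z(t)=U(t,0)x$, $t\ge0$, be the solution of $\dot z(t)=A(t)z(t)$, $t\ge0$, $z(0)=x$. Then the following hold. (i) For any initial value $x\in X$ the solution satisfies $$\|z(t)-z_0(t)\|\to0,\quad t\to\infty,$$ where $z_0\colon\mathbb{R}_+\to X$ is the $\tau$-periodic solution with initial condition $z_0(0)=Px$, that is, $z_0(t)=U(t,0)Px$. In particular, the system is asymptotically periodic. The system is stable if and only if $(B^*,A_0)$ is approximately observable on $(0,\tau)$. (ii) There exist $M,\beta>0$ such that $$\|z(t)-z_0(t)\|\le Me^{-\beta t}\|x\|,\quad t\ge0,\ x\in X,$$ if and only if $(B^*,A_0)$ is exactly $Z$-observable on $(0,\tau)$. (iii) In any case, if $x\in X$ is such that $x-Px\in\operatorname{Ran}\big((I-T)^\gamma\big)$ for some $\gamma>0$,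 then $$\|z(t)-z_0(t)\|=o(t^{-\gamma}),\quad t\to\infty.$$ (iv) There exists a dense subspace $X_0$ of $X$ such that for all $x\in X_0$ the convergence $\|z(t)-z_0(t)\|\to0$ is superpolynomially fast, that is, $\|z(t)-z_0(t)\|=o(t^{-\gamma})$ as $t\to\infty$ for all $\gamma>0$.
   Context: An evolution family on $X$ is a family $(U(t,s))_{t\ge s\ge0}$ in $\mathcal{B}(X)$ with $U(t,t)=I$, $U(t,r)U(r,s)=U(t,s)$ for $t\ge r\ge s\ge0$, and $(t,s)\mapsto U(t,s)x$ continuous for every $x\in X$. The evolution family of contractions associated with $A(t)=A_0-B(t)B(t)^*$ is the one for which, for every $x\in X$, $z(t)=U(t,0)x$ satisfies $$z(t)=T_0(t)x-\int_0^tT_0(t-s)B(s)B(s)^*z(s)\,ds,\quad t\ge0;$$ such a family exists, and $z$ is called the (mild) solution with initial value $x$. For a subset $Z\subseteq X$, the pair $(B^*,A_0)$ is approximately $Z$-observable on $(0,\tau)$ if for all $x\in Z$ the condition $\int_0^\tau\|B(t)^*T_0(t)x\|^2\,dt=0$ implies $x=0$; it is exactly $Z$-observable on $(0,\tau)$ if there is $\kappa>0$ with $\int_0^\tau\|B(t)^*T_0(t)x\|^2\,dt\ge\kappa^2\|x\|^2$ for all $x\in Z$. If $Z=X$ one simply says approximately or exactly observable. The system is asymptotically periodic if for every $x\in X$ there is a periodic function $z_0\colon\mathbb{R}_+\to X$ with $\|z(t)-z_0(t)\|\to0$ as $t\to\infty$; it is stable if $\|z(t)\|\to0$ as $t\to\infty$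 for every $x\in X$. Since $T$ is a contraction, $I-T$ is sectorial and $(I-T)^\gamma$ denotes its fractional power. *)

theory Defs
  imports "HOL-Analysis.Analysis" "HOL-Library.Landau_Symbols"
begin

section \<open>Complex Hilbert spaces\<close>

text \<open>
  The underlying real Hilbert space carries the inner product \<^term>\<open>Re (cinner x y)\<close>; norm, topology
  and \<^typ>\<open>'a \<Rightarrow>\<^sub>L 'b\<close> are those of the real structure. The operator norm over real and over complex
  scalars is the same number, so the bounded operators between complex Hilbert spaces are the
  complex-linear members of \<^typ>\<open>'a \<Rightarrow>\<^sub>L 'b\<close>, with the norm of that type.
\<close>

class complex_hilbert = real_inner + complete_space +
  fixes scaleC :: "complex \<Rightarrow> 'a \<Rightarrow> 'a" (infixr "*\<^sub>C" 75)
    and cinner :: "'a \<Rightarrow> 'a \<Rightarrow> complex"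
  assumes scaleC_add_right: "c *\<^sub>C (x + y) = c *\<^sub>C x + c *\<^sub>C y"
    and scaleC_add_left: "(c + d) *\<^sub>C x = c *\<^sub>C x + d *\<^sub>C x"
    and scaleC_scaleC: "c *\<^sub>C d *\<^sub>C x = (c * d) *\<^sub>C x"
    and scaleR_scaleC: "r *\<^sub>R x = complex_of_real r *\<^sub>C x"
    and cinner_commute: "cinner x y = cnj (cinner y x)"
    and cinner_add_left: "cinner (x + y) z = cinner x z + cinner y z"
    and cinner_scaleC_left: "cinner (c *\<^sub>C x) y = c * cinner x y"
    and inner_eq_Re_cinner: "inner x y = Re (cinner x y)"

definition csubspace :: "'a::complex_hilbert set \<Rightarrow> bool" where
  "csubspace S \<longleftrightarrow> 0 \<in> S \<and> (\<forall>x\<in>S. \<forall>y\<in>S. x + y \<in> S) \<and> (\<forall>c. \<forall>x\<in>S. c *\<^sub>C x \<in> S)"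

definition clinear :: "('a::complex_hilbert \<Rightarrow>\<^sub>L 'b::complex_hilbert) \<Rightarrow> bool" where
  "clinear f \<longleftrightarrow> (\<forall>c x. f (c *\<^sub>C x) = c *\<^sub>C f x)"

definition cadjoint :: "('a::complex_hilbert \<Rightarrow>\<^sub>L 'b::complex_hilbert) \<Rightarrow> 'b \<Rightarrow>\<^sub>L 'a" where
  "cadjoint f = (THE g :: 'b \<Rightarrow>\<^sub>L 'a. \<forall>x y. cinner (f x) y = cinner x (g y))"

definition orth_complement :: "'a::complex_hilbert set \<Rightarrow> 'a set" where
  "orth_complement S = {x. \<forall>y\<in>S. cinner x y = 0}"

definition orth_projection :: "'a::complex_hilbert set \<Rightarrow> 'a \<Rightarrow> 'a" where
  "orth_projection S x = (THE p. p \<in> S \<and> x - p \<in> orth_complement S)"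


section \<open>Unitary groups and evolution families\<close>

definition unitary_group :: "(real \<Rightarrow> 'a::complex_hilbert \<Rightarrow>\<^sub>L 'a) \<Rightarrow> bool" where
  "unitary_group T \<longleftrightarrow>
     (\<forall>t. clinear (T t) \<and> surj (blinfun_apply (T t)) \<and> (\<forall>x y. cinner (T t x) (T t y) = cinner x y)) \<and>
     T 0 = id_blinfun \<and>
     (\<forall>s t. T (s + t) = T s o\<^sub>L T t) \<and>
     (\<forall>x. continuous_on UNIV (\<lambda>t. T t x))"

text \<open>The generator is an unbounded operator; it is represented by its graph.\<close>

definition generator :: "(real \<Rightarrow> 'a::complex_hilbert \<Rightarrow>\<^sub>L 'a) \<Rightarrow> ('a \<times> 'a) set" where
  "generator T = {(x, y). ((\<lambda>h. (1 / h) *\<^sub>R (T h x - x)) \<longlongrightarrow> y) (at 0)}"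

definition evolution_family :: "(real \<Rightarrow> real \<Rightarrow> 'a::complex_hilbert \<Rightarrow>\<^sub>L 'a) \<Rightarrow> bool" where
  "evolution_family U \<longleftrightarrow>
     (\<forall>s t. 0 \<le> s \<and> s \<le> t \<longrightarrow> clinear (U t s)) \<and>
     (\<forall>t\<ge>0. U t t = id_blinfun) \<and>
     (\<forall>s r t. 0 \<le> s \<and> s \<le> r \<and> r \<le> t \<longrightarrow> U t r o\<^sub>L U r s = U t s) \<and>
     (\<forall>x. continuous_on {(t, s). 0 \<le> s \<and> s \<le> t} (\<lambda>(t, s). U t s x))"

text \<open>
  Bochner's notion of measurability and the space $L^2_{loc}$ of functions on $[0,\infty)$. Strong
  measurability is needed because the space of operators is in general not separable.
\<close>

definition strongly_measurable :: "'s measure \<Rightarrow> ('s \<Rightarrow> 'b::real_normed_vector) \<Rightarrow> bool" where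
  "strongly_measurable M f \<longleftrightarrow>
     (\<exists>s. (\<forall>n::nat. simple_function M (s n)) \<and> (AE t in M. (\<lambda>n. s n t) \<longlonglongrightarrow> f t))"

definition L2_loc :: "(real \<Rightarrow> 'b::real_normed_vector) \<Rightarrow> bool" where
  "L2_loc f \<longleftrightarrow> strongly_measurable (lebesgue_on {0..}) f \<and>
     (\<forall>r\<ge>0. (\<lambda>t. (norm (f t))\<^sup>2) integrable_on {0..r})"

text \<open>
  \<open>U\<close> is the evolution family of contractions associated with $A(t) = A_0 - B(t)B(t)^*$, where \<open>T0\<close>
  is the group generated by $A_0$. The library restricts the Bochner integral to separable spaces,
  so vector-valued integrals are Henstock-Kurzweil integrals, which extend the Bochner integral;
  the integrand below is Bochner integrable whenever \<open>B\<close> is in \<^const>\<open>L2_loc\<close>.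
\<close>

definition contraction_family_of ::
    "(real \<Rightarrow> 'a::complex_hilbert \<Rightarrow>\<^sub>L 'a) \<Rightarrow> (real \<Rightarrow> 'v::complex_hilbert \<Rightarrow>\<^sub>L 'a) \<Rightarrow>
      (real \<Rightarrow> real \<Rightarrow> 'a \<Rightarrow>\<^sub>L 'a) \<Rightarrow> bool" where
  "contraction_family_of T0 B U \<longleftrightarrow>
     evolution_family U \<and>
     (\<forall>s t. 0 \<le> s \<and> s \<le> t \<longrightarrow> norm (U t s) \<le> 1) \<and>
     (\<forall>x. \<forall>t\<ge>0. ((\<lambda>s. T0 (t - s) (B s (cadjoint (B s) (U s 0 x))))
        has_integral (T0 t x - U t 0 x)) {0..t})"


section \<open>Observability and asymptotics\<close>

definition observed_energy ::
    "(real \<Rightarrow> 'v::complex_hilbert \<Rightarrow>\<^sub>L 'a::complex_hilbert) \<Rightarrow> (real \<Rightarrow> 'a \<Rightarrow>\<^sub>L 'a) \<Rightarrow> real \<Rightarrow> 'a \<Rightarrow> real" where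
  "observed_energy B T0 \<tau> x = integral {0..\<tau>} (\<lambda>t. (norm (cadjoint (B t) (T0 t x)))\<^sup>2)"

definition approx_observable ::
    "(real \<Rightarrow> 'v::complex_hilbert \<Rightarrow>\<^sub>L 'a::complex_hilbert) \<Rightarrow> (real \<Rightarrow> 'a \<Rightarrow>\<^sub>L 'a) \<Rightarrow> real \<Rightarrow> 'a set \<Rightarrow> bool" where
  "approx_observable B T0 \<tau> Z \<longleftrightarrow> (\<forall>x\<in>Z. observed_energy B T0 \<tau> x = 0 \<longrightarrow> x = 0)"

definition exactly_observable ::
    "(real \<Rightarrow> 'v::complex_hilbert \<Rightarrow>\<^sub>L 'a::complex_hilbert) \<Rightarrow> (real \<Rightarrow> 'a \<Rightarrow>\<^sub>L 'a) \<Rightarrow> real \<Rightarrow> 'a set \<Rightarrow> bool" where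
  "exactly_observable B T0 \<tau> Z \<longleftrightarrow>
     (\<exists>\<kappa>>0. \<forall>x\<in>Z. observed_energy B T0 \<tau> x \<ge> \<kappa>\<^sup>2 * (norm x)\<^sup>2)"

definition periodic_with :: "real \<Rightarrow> (real \<Rightarrow> 'a) \<Rightarrow> bool" where
  "periodic_with p f \<longleftrightarrow> (\<forall>t\<ge>0. f (t + p) = f t)"

definition asymptotically_periodic :: "(real \<Rightarrow> real \<Rightarrow> 'a::complex_hilbert \<Rightarrow>\<^sub>L 'a) \<Rightarrow> bool" where
  "asymptotically_periodic U \<longleftrightarrow>
     (\<forall>x. \<exists>z0. (\<exists>p>0. periodic_with p z0) \<and> ((\<lambda>t. norm (U t 0 x - z0 t)) \<longlongrightarrow> 0) at_top)"

definition stable :: "(real \<Rightarrow> real \<Rightarrow> 'a::complex_hilbert \<Rightarrow>\<^sub>L 'a) \<Rightarrow> bool" where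
  "stable U \<longleftrightarrow> (\<forall>x. ((\<lambda>t. norm (U t 0 x)) \<longlongrightarrow> 0) at_top)"


section \<open>Fractional powers of bounded sectorial operators\<close>

text \<open>
  Balakrishnan's formula: for $0 < \alpha < 1$,
  \[ S^\alpha x = \frac{\sin \pi\alpha}{\pi}
       \int_0^\infty \lambda^{\alpha-1} (\lambda + S)^{-1} S x \, d\lambda, \]
  and $S^{n+\alpha} = S^n S^\alpha$ for integer $n \ge 0$, with $S^0 = I$. For sectorial \<open>S\<close>, the map
  $\lambda + S$ is bijective for every $\lambda > 0$, so \<^const>\<open>inv\<close> is its inverse.
\<close>

definition frac_power_aux :: "('a::complex_hilbert \<Rightarrow>\<^sub>L 'a) \<Rightarrow> real \<Rightarrow> 'a \<Rightarrow> 'a" where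
  "frac_power_aux S \<alpha> x =
     (if \<alpha> = 0 then x
      else (sin (pi * \<alpha>) / pi) *\<^sub>R
        integral {0<..} (\<lambda>l. (l powr (\<alpha> - 1)) *\<^sub>R inv (\<lambda>y. l *\<^sub>R y + S y) (S x)))"

definition frac_power :: "('a::complex_hilbert \<Rightarrow>\<^sub>L 'a) \<Rightarrow> real \<Rightarrow> 'a \<Rightarrow> 'a" where
  "frac_power S \<gamma> x = (blinfun_apply S ^^ nat \<lfloor>\<gamma>\<rfloor>) (frac_power_aux S (frac \<gamma>) x)"

end

theory Submission
  imports Defs
begin

text \<open>
  Everything is decided by the powers of the monodromy operator \<open>T = U(\<tau>,0)\<close>. Write \<open>S = I - T\<close>
  and let \<open>q(x)\<close> be the energy of \<open>x\<close> observed over one period of the free motion \<open>T0(t)x\<close>, so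
  that \<open>Y = {q = 0}\<close>.

  Pairing the variation-of-constants formula with \<open>T0(t)y\<close> moves the unitary group to the other
  side and leaves, with the real inner product, a scalar identity for \<open>z(t) = U(t,0)x\<close>,
  \<open>\<integral>\<^sub>0\<^sup>t \<langle>B\<^sup>*z, B\<^sup>*T0(s)y\<rangle> ds = \<langle>x,y\<rangle> - \<langle>z(t), T0(t)y\<rangle>\<close>. It yields the energy balance
  \<open>2 \<integral>\<^sub>0\<^sup>t \<parallel>B\<^sup>*z\<parallel>\<^sup>2 = \<parallel>x\<parallel>\<^sup>2 - \<parallel>z(t)\<parallel>\<^sup>2\<close> (\<open>energy_identity\<close>), hence uniqueness of solutions, hence
  \<open>U(t + \<tau>,0) = U(t,0) T\<close>. It also yields the two inequalities that carry the rest of the proof: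
  \<open>\<langle>Sx,y\<rangle>\<^sup>2 \<le> q(x) q(y)\<close> (\<open>monodromy_form_bound\<close>) and \<open>q(x) \<le> K (\<parallel>x\<parallel>\<^sup>2 - \<parallel>Tx\<parallel>\<^sup>2)\<close>
  (\<open>energy_le_dissipation\<close>). From here on only these two inequalities for \<open>T\<close> matter.

  They show that \<open>q(x) = 0\<close> means \<open>Tx = x\<close>, and that \<open>X\<close> is the orthogonal sum of \<open>Y = ker S\<close> and
  the closure of the range of \<open>S\<close>. For \<open>y\<close> a complex multiple of \<open>x\<close> they confine the numerical range
  of \<open>S\<close> to a sector, so one expects \<open>T\<close> to be a Ritt operator: \<open>\<parallel>T\<^sup>n S\<parallel> = O(1/n)\<close>. Instead of contour
  integrals, a discrete energy method proves this: along an orbit \<open>x\<^sub>n = T\<^sup>n x\<close> the quantity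
  \<open>c\<^sub>1 \<parallel>x\<^sub>n\<parallel>\<^sup>2 + n \<langle>Sx\<^sub>n, x\<^sub>n\<rangle> + n\<^sup>2 \<parallel>Sx\<^sub>n\<parallel>\<^sup>2\<close> does not increase (\<open>lyapunov_step\<close>). Splitting \<open>n\<close> into
  pieces gives \<open>\<parallel>T\<^sup>n S\<^sup>k\<parallel> = O(n\<^sup>-\<^sup>k)\<close>.

  The four claims follow. Convergence holds because \<open>T\<^sup>n S v\<close> tends to zero and such vectors are dense
  in \<open>Z\<close>. Exact observability makes \<open>T\<close> a strict contraction on \<open>Z\<close>, and conversely a power of
  \<open>T\<close> that halves norms on \<open>Z\<close> bounds \<open>S\<close>, and with it \<open>q\<close>, from below there. For a fractional
  power the estimates for \<open>T\<^sup>n S\<^sup>k\<close> and \<open>T\<^sup>n S\<^sup>k\<^sup>+\<^sup>1\<close> are interpolated inside Balakrishnan's integral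
  (\<open>Tpow_balakrishnan_bound\<close>). Superpolynomial decay holds on the intersection of the ranges of all
  \<open>S\<^sup>k\<close>, which is dense in \<open>Z\<close> by a Mittag-Leffler argument (\<open>mittag_leffler_dense\<close>).
\<close>

section \<open>Projections and adjoints in Hilbert spaces\<close>

text \<open>
  A minimizing sequence for the distance to \<open>S\<close> is Cauchy by the parallelogram law, since midpoints
  stay in \<open>S\<close>; minimality of the limit under perturbations along \<open>y\<close> is orthogonality to \<open>y\<close>.
\<close>
lemma closed_subspace_projection:
  fixes S :: "'a::{real_inner,banach} set"
  assumes S: "subspace S" "closed S"
  shows "\<exists>p\<in>S. \<forall>y\<in>S. (x - p) \<bullet> y = 0"
proof -
  define D where "D = Inf ((\<lambda>p. (norm (x - p))\<^sup>2) ` S)"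
  have "S \<noteq> {}" using subspace_0[OF S(1)] by auto
  have bdd: "bdd_below ((\<lambda>p. (norm (x - p))\<^sup>2) ` S)" by (rule bdd_belowI[of _ 0]) auto
  have lower: "D \<le> (norm (x - p))\<^sup>2" if "p \<in> S" for p
    unfolding D_def using bdd that by (intro cInf_lower) auto
  have "\<exists>p\<in>S. (norm (x - p))\<^sup>2 < D + 1 / real (Suc n)" for n
    using cInf_less_iff[of "(\<lambda>p. (norm (x - p))\<^sup>2) ` S" "D + 1 / real (Suc n)"] \<open>S \<noteq> {}\<close> bdd
    unfolding D_def by auto
  then obtain f where f: "f n \<in> S" "(norm (x - f n))\<^sup>2 < D + 1 / real (Suc n)" for n
    by metis
  have close: "(norm (f m - f n))\<^sup>2 \<le> 2 / real (Suc m) + 2 / real (Suc n)" for m n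
  proof -
    have "(1/2) *\<^sub>R (f m + f n) \<in> S"
      using f(1) S(1) by (simp add: subspace_add subspace_scale)
    from lower[OF this] have "D \<le> (norm (x - (1/2) *\<^sub>R (f m + f n)))\<^sup>2" .
    moreover have "(norm (f m - f n))\<^sup>2 = 2 * (norm (x - f m))\<^sup>2 + 2 * (norm (x - f n))\<^sup>2
        - 4 * (norm (x - (1/2) *\<^sub>R (f m + f n)))\<^sup>2"
      by (simp add: power2_norm_eq_inner algebra_simps inner_commute)
    ultimately show ?thesis using f(2)[of m] f(2)[of n] by linarith
  qed
  have "Cauchy f"
  proof (rule metric_CauchyI)
    fix e :: real assume "0 < e"
    then obtain N where N: "inverse (real (Suc N)) < e\<^sup>2 / 4"
      using reals_Archimedean[of "e\<^sup>2 / 4"] by auto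
    show "\<exists>M. \<forall>m\<ge>M. \<forall>n\<ge>M. dist (f m) (f n) < e"
    proof (intro exI allI impI)
      fix m n assume "N \<le> m" "N \<le> n"
      then have "inverse (real (Suc m)) \<le> inverse (real (Suc N))"
        "inverse (real (Suc n)) \<le> inverse (real (Suc N))"
        by (auto intro!: le_imp_inverse_le)
      then have "(norm (f m - f n))\<^sup>2 < e\<^sup>2" using close[of m n, unfolded divide_inverse] N by linarith
      then show "dist (f m) (f n) < e"
        using \<open>0 < e\<close> by (simp add: dist_norm power2_less_imp_less)
    qed
  qed
  then obtain p where p: "f \<longlonglongrightarrow> p" using Cauchy_convergent_iff convergent_def by blast
  have "p \<in> S" using S(2) f(1) p closed_sequentially by blast
  have "(\<lambda>n. (norm (x - f n))\<^sup>2) \<longlonglongrightarrow> (norm (x - p))\<^sup>2" using p by (intro tendsto_intros)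
  moreover have "(\<lambda>n. D + 1 / real (Suc n)) \<longlonglongrightarrow> D + 0"
    using LIMSEQ_inverse_real_of_nat by (intro tendsto_intros) (simp add: inverse_eq_divide)
  ultimately have "(norm (x - p))\<^sup>2 \<le> D + 0"
    by (rule LIMSEQ_le) (use f(2) less_imp_le in blast)
  then have p_min: "(norm (x - p))\<^sup>2 \<le> D" by simp
  show ?thesis
  proof (rule bexI[OF _ \<open>p \<in> S\<close>], rule ballI)
    fix y assume "y \<in> S"
    show "(x - p) \<bullet> y = 0"
    proof (cases "y = 0")
      case False
      \<comment> \<open>This step length minimizes the distance from \<open>x\<close> to the line through \<open>p\<close> in direction \<open>y\<close>.\<close>
      define t where "t = ((x - p) \<bullet> y) / (y \<bullet> y)"
      have "p + t *\<^sub>R y \<in> S" using \<open>p \<in> S\<close> \<open>y \<in> S\<close> S(1) by (simp add: subspace_add subspace_scale)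
      from lower[OF this] have "D \<le> (norm ((x - p) - t *\<^sub>R y))\<^sup>2"
        by (simp add: diff_diff_eq)
      with p_min have "(norm (x - p))\<^sup>2 \<le> (norm ((x - p) - t *\<^sub>R y))\<^sup>2" by (rule order_trans)
      also have "\<dots> = (norm (x - p))\<^sup>2 - 2 * t * ((x - p) \<bullet> y) + t * (t * (y \<bullet> y))"
        by (simp add: power2_norm_eq_inner inner_diff_left inner_diff_right inner_commute algebra_simps)
      also have "t * (y \<bullet> y) = (x - p) \<bullet> y" using False by (simp add: t_def)
      finally have "t * ((x - p) \<bullet> y) \<le> 0" by simp
      then have "((x - p) \<bullet> y)\<^sup>2 / (y \<bullet> y) \<le> 0" by (simp add: t_def power2_eq_square)
      moreover have "0 < y \<bullet> y" using False by simp
      ultimately have "((x - p) \<bullet> y)\<^sup>2 \<le> 0" by (simp only: divide_le_0_iff) auto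
      then show ?thesis by simp
    qed simp
  qed
qed

lemma subspace_closure:
  fixes S :: "'a::real_normed_vector set"
  assumes S: "subspace S"
  shows "subspace (closure S)"
  unfolding subspace_def
proof (intro conjI ballI allI)
  show "0 \<in> closure S" using subspace_0[OF S] closure_subset by blast
  fix x assume "x \<in> closure S"
  then obtain f where f: "\<And>n. f n \<in> S" "f \<longlonglongrightarrow> x" unfolding closure_sequential by blast
  show "c *\<^sub>R x \<in> closure S" for c
    unfolding closure_sequential
    by (rule exI[of _ "\<lambda>n. c *\<^sub>R f n"]) (simp add: f subspace_scale[OF S] tendsto_scaleR)
  fix y assume "y \<in> closure S"
  then obtain g where g: "\<And>n. g n \<in> S" "g \<longlonglongrightarrow> y" unfolding closure_sequential by blast
  show "x + y \<in> closure S"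
    unfolding closure_sequential
    by (rule exI[of _ "\<lambda>n. f n + g n"]) (simp add: f g subspace_add[OF S] tendsto_add)
qed

text \<open>
  The representing vector is normal to the kernel, which has codimension one.
\<close>
lemma riesz_representation:
  fixes f :: "'a::{real_inner,banach} \<Rightarrow> real"
  assumes "bounded_linear f"
  shows "\<exists>g. \<forall>x. f x = x \<bullet> g"
proof (cases "\<forall>x. f x = 0")
  case True then show ?thesis by (intro exI[of _ 0]) simp
next
  case False
  interpret bounded_linear f by fact
  obtain x0 where x0: "f x0 \<noteq> 0" using False by blast
  have "closed {x. f x = 0}"
    by (intro closed_Collect_eq continuous_on continuous_intros)
  moreover have "subspace {x. f x = 0}" by (auto simp: subspace_def add scale zero)
  ultimately obtain p where p: "f p = 0" "\<And>y. f y = 0 \<Longrightarrow> (x0 - p) \<bullet> y = 0"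
    using closed_subspace_projection[of "{x. f x = 0}" x0] by auto
  define n where "n = x0 - p"
  have fn: "f n \<noteq> 0" using x0 p(1) by (simp add: n_def diff)
  then have "n \<noteq> 0" using zero by auto
  have "f x = x \<bullet> ((f n / (n \<bullet> n)) *\<^sub>R n)" for x
  proof -
    have "f (x - (f x / f n) *\<^sub>R n) = 0" using fn by (simp add: diff scale)
    from p(2)[OF this] have "n \<bullet> x = (f x / f n) * (n \<bullet> n)"
      by (simp add: n_def[symmetric] inner_diff_right)
    then show ?thesis using fn \<open>n \<noteq> 0\<close> by (simp add: inner_commute field_simps)
  qed
  then show ?thesis by blast
qed

lemma real_adjoint_exists:
  fixes f :: "'a::{real_inner,banach} \<Rightarrow>\<^sub>L 'b::real_inner"
  shows "\<exists>g :: 'b \<Rightarrow>\<^sub>L 'a. \<forall>x y. f x \<bullet> y = x \<bullet> g y"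
proof -
  have "\<exists>g. \<forall>x. f x \<bullet> y = x \<bullet> g" for y
    by (rule riesz_representation)
       (intro bounded_linear_compose[OF bounded_linear_inner_left] blinfun.bounded_linear_right)
  then obtain g where g: "f x \<bullet> y = x \<bullet> g y" for x y by metis
  have "bounded_linear g"
  proof (rule bounded_linear_intro[where K = "norm f"])
    fix a b r
    show "g (a + b) = g a + g b"
      by (rule vector_eq_ldot[THEN iffD1]) (simp add: inner_add_right g[symmetric])
    show "g (r *\<^sub>R a) = r *\<^sub>R g a"
      by (rule vector_eq_ldot[THEN iffD1]) (simp add: g[symmetric])
    have "norm (g a) * norm (g a) = f (g a) \<bullet> a"
      by (simp add: g power2_norm_eq_inner[symmetric] power2_eq_square)
    also have "\<dots> \<le> norm (f (g a)) * norm a" by (rule norm_cauchy_schwarz)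
    also have "\<dots> \<le> norm f * norm (g a) * norm a" by (intro mult_right_mono norm_blinfun) auto
    finally have "norm (g a) * norm (g a) \<le> norm (g a) * (norm a * norm f)"
      by (simp add: algebra_simps)
    then show "norm (g a) \<le> norm a * norm f"
      by (cases "norm (g a) = 0") (auto simp: mult_le_cancel_left)
  qed
  then have "\<forall>x y. f x \<bullet> y = x \<bullet> Blinfun g y" by (simp add: bounded_linear_Blinfun_apply g)
  then show ?thesis by blast
qed

text \<open>
  The adjoint for the real inner product exists for every bounded real-linear map. This matters
  because the simple functions that approximate \<open>B\<close> need not take complex-linear values, so
  \<^const>\<open>cadjoint\<close> is meaningless for them.
\<close>
definition real_adjoint :: "('a::{real_inner,banach} \<Rightarrow>\<^sub>L 'b::real_inner) \<Rightarrow> 'b \<Rightarrow>\<^sub>L 'a" where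
  "real_adjoint f = (SOME g :: 'b \<Rightarrow>\<^sub>L 'a. \<forall>x y. f x \<bullet> y = x \<bullet> g y)"

lemma real_adjoint:
  fixes f :: "'a::{real_inner,banach} \<Rightarrow>\<^sub>L 'b::real_inner"
  shows "f x \<bullet> y = x \<bullet> real_adjoint f y"
  unfolding real_adjoint_def using someI_ex[OF real_adjoint_exists[of f]] by blast

lemma real_adjoint_diff:
  fixes f :: "'a::{real_inner,banach} \<Rightarrow>\<^sub>L 'b::real_inner"
  shows "real_adjoint (f - g) y = real_adjoint f y - real_adjoint g y"
  by (rule vector_eq_ldot[THEN iffD1])
     (simp add: inner_diff_right inner_diff_left real_adjoint[symmetric] blinfun.diff_left)

lemma norm_real_adjoint_apply:
  fixes f :: "'a::{real_inner,banach} \<Rightarrow>\<^sub>L 'b::real_inner"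
  shows "norm (real_adjoint f y) \<le> norm f * norm y"
proof -
  let ?g = "real_adjoint f y"
  have "norm ?g * norm ?g = f ?g \<bullet> y"
    by (simp add: real_adjoint power2_norm_eq_inner[symmetric] power2_eq_square)
  also have "\<dots> \<le> norm (f ?g) * norm y" by (rule norm_cauchy_schwarz)
  also have "\<dots> \<le> norm f * norm ?g * norm y" by (intro mult_right_mono norm_blinfun) auto
  finally have "norm ?g * norm ?g \<le> norm ?g * (norm f * norm y)" by (simp add: algebra_simps)
  then show ?thesis by (cases "norm ?g = 0") (auto simp: mult_le_cancel_left)
qed

instance complex_hilbert \<subseteq> banach ..

lemma cinner_scaleC_right: "cinner x (c *\<^sub>C y) = cnj c * cinner x y"
  unfolding cinner_commute[of x "c *\<^sub>C y"] cinner_scaleC_left cinner_commute[of x y] by simp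

lemma Im_cinner: "Im (cinner x y) = x \<bullet> (\<i> *\<^sub>C y)"
  by (simp add: inner_eq_Re_cinner cinner_scaleC_right)

text \<open>
  Both parts of the complex inner product are real inner products, the imaginary part after
  rotation by \<open>\<i>\<close>, which a complex-linear map commutes with.
\<close>
lemma cadjoint_eq_real_adjoint:
  fixes f :: "'a::complex_hilbert \<Rightarrow>\<^sub>L 'b::complex_hilbert"
  assumes "clinear f"
  shows "cadjoint f = real_adjoint f"
  unfolding cadjoint_def
proof (rule the_equality)
  have left: "Im (cinner x y) = - ((\<i> *\<^sub>C x) \<bullet> y)" for x y :: "'z::complex_hilbert"
    by (simp add: inner_eq_Re_cinner cinner_scaleC_left)
  show "\<forall>x y. cinner (f x) y = cinner x (real_adjoint f y)"
    using assms by (simp add: complex_eq_iff left inner_eq_Re_cinner[symmetric] clinear_def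
        real_adjoint[symmetric])
next
  fix g :: "'b \<Rightarrow>\<^sub>L 'a" assume g: "\<forall>x y. cinner (f x) y = cinner x (g y)"
  show "g = real_adjoint f"
  proof (rule blinfun_eqI)
    fix y
    have "x \<bullet> g y = x \<bullet> real_adjoint f y" for x
      using g by (metis inner_eq_Re_cinner real_adjoint)
    then show "g y = real_adjoint f y" using vector_eq_ldot by blast
  qed
qed

lemma scaleC_diff_right: "c *\<^sub>C (x - y) = c *\<^sub>C x - c *\<^sub>C y"
  using scaleC_add_right[of c "x - y" y] by simp

lemma funpow_clinear:
  fixes f :: "'a::complex_hilbert \<Rightarrow>\<^sub>L 'a"
  assumes "clinear f"
  shows "(blinfun_apply f ^^ n) (c *\<^sub>C x) = c *\<^sub>C (blinfun_apply f ^^ n) x"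
  using assms by (induction n) (simp_all add: clinear_def)

text \<open>
  On a set invariant under multiplication by \<open>\<i>\<close> it makes no difference whether orthogonality is
  understood in the complex or in the real sense. This reduces the whole problem to real geometry.
\<close>
lemma orth_complement_eq_real:
  assumes "\<And>y. y \<in> Y \<Longrightarrow> \<i> *\<^sub>C y \<in> Y"
  shows "orth_complement Y = {x. \<forall>y\<in>Y. x \<bullet> y = 0}"
  using assms by (auto simp: orth_complement_def complex_eq_iff Im_cinner inner_eq_Re_cinner[symmetric])

section \<open>Integrals of observed energies\<close>

text \<open>
  Integrating \<open>2 a f \<le> a\<^sup>2 g + h\<close> gives a quadratic inequality in the real parameter \<open>a\<close>, whose
  discriminant is the claim. In this form the lemma covers both genuine Cauchy-Schwarz estimates and
  those in which only \<open>f\<^sup>2 \<le> g h\<close> is known.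
\<close>
lemma has_integral_Cauchy_Schwarz:
  fixes f g h :: "'n::euclidean_space \<Rightarrow> real"
  assumes f: "(f has_integral I) S" and g: "(g has_integral G) S" and h: "(h has_integral H) S"
    and le: "\<And>s. s \<in> S \<Longrightarrow> 0 \<le> g s \<and> 0 \<le> h s \<and> (f s)\<^sup>2 \<le> g s * h s"
  shows "I\<^sup>2 \<le> G * H"
proof -
  have quad: "2 * a * I \<le> a\<^sup>2 * G + H" for a
  proof (rule has_integral_le)
    show "((\<lambda>s. 2 * a * f s) has_integral 2 * a * I) S" by (intro has_integral_mult_right f)
    show "((\<lambda>s. a\<^sup>2 * g s + h s) has_integral a\<^sup>2 * G + H) S"
      by (intro has_integral_add has_integral_mult_right g h)
    fix s assume s: "s \<in> S"
    have "(2 * a * f s)\<^sup>2 = 4 * a\<^sup>2 * (f s)\<^sup>2" by (simp add: power_mult_distrib)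
    also have "\<dots> \<le> 4 * a\<^sup>2 * (g s * h s)" using le[OF s] by (intro mult_left_mono) auto
    also have "\<dots> \<le> (a\<^sup>2 * g s + h s)\<^sup>2"
      using zero_le_power2[of "a\<^sup>2 * g s - h s"] by (simp add: power2_eq_square algebra_simps)
    finally show "2 * a * f s \<le> a\<^sup>2 * g s + h s"
      by (rule power2_le_imp_le) (use le[OF s] in auto)
  qed
  have "G \<ge> 0" using has_integral_nonneg[OF g] le by blast
  show ?thesis
  proof (cases "G = 0")
    case True
    have "I = 0"
    proof (rule ccontr)
      assume "I \<noteq> 0"
      \<comment> \<open>The parameter is chosen so that the left-hand side of the quadratic inequality is \<open>H + 1\<close>.\<close>
      then show False using quad[of "(H + 1) / (2 * I)"] True by simp
    qed
    then show ?thesis using True by simp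
  next
    case False
    then show ?thesis using quad[of "I / G"] \<open>G \<ge> 0\<close>
      by (simp add: power2_eq_square field_simps)
  qed
qed

text \<open>
  Simple functions \<open>b\<^sub>n \<rightarrow> B\<close> give measurable approximations of the integrand, because for each of the
  finitely many values \<open>c\<close> of \<open>b\<^sub>n\<close> the function \<open>t \<mapsto> \<parallel>c\<^sup>* z(t)\<parallel>\<^sup>2\<close> is continuous. Boundedness of \<open>z\<close>
  on compact intervals supplies an integrable majorant.
\<close>
lemma real_adjoint_energy_integrable:
  fixes B :: "real \<Rightarrow> 'v::{real_inner,banach} \<Rightarrow>\<^sub>L 'a::{real_inner,banach}"
  assumes B: "L2_loc B" and z: "continuous_on {0..} z" and r: "0 \<le> r"
  shows "(\<lambda>t. (norm (real_adjoint (B t) (z t)))\<^sup>2) integrable_on {0..r}"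
proof -
  let ?M = "lebesgue_on {0::real..}"
  define f where "f t = (norm (real_adjoint (B t) (z t)))\<^sup>2" for t
  obtain b where b: "\<And>n. simple_function ?M (b n)" and lim: "AE t in ?M. (\<lambda>n. b n t) \<longlonglongrightarrow> B t"
    using B unfolding L2_loc_def strongly_measurable_def by blast
  define g where "g n t = (norm (real_adjoint (b n t) (z t)))\<^sup>2" for n t
  obtain N where N: "N \<in> null_sets ?M" "{t \<in> space ?M. \<not> (\<lambda>n. b n t) \<longlonglongrightarrow> B t} \<subseteq> N"
    using lim unfolding eventually_ae_filter by blast
  have meas_g: "g n \<in> borel_measurable ?M" for n
    unfolding g_def
  proof (rule measurable_compose_countable'[where g = "b n" and I = "b n ` space ?M"
        and f = "\<lambda>c t. (norm (real_adjoint c (z t)))\<^sup>2"])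
    show "(\<lambda>t. (norm (real_adjoint c (z t)))\<^sup>2) \<in> borel_measurable ?M" for c
      by (intro continuous_imp_measurable_on_sets_lebesgue continuous_intros z) auto
    show "b n \<in> ?M \<rightarrow>\<^sub>M count_space (b n ` space ?M)"
      using simple_functionD[OF b[of n]] by (simp add: measurable_count_space_eq_countable countable_finite)
    show "countable (b n ` space ?M)"
      using simple_functionD(1)[OF b[of n]] by (rule countable_finite)
  qed
  have g_lim: "(\<lambda>n. g n t) \<longlonglongrightarrow> f t" if t: "(\<lambda>n. b n t) \<longlonglongrightarrow> B t" for t
  proof -
    have "(\<lambda>n. real_adjoint (b n t) (z t)) \<longlonglongrightarrow> real_adjoint (B t) (z t)"
    proof (rule Lim_null_comparison[THEN LIM_zero_cancel])
      show "\<forall>\<^sub>F n in sequentially.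
          norm (real_adjoint (b n t) (z t) - real_adjoint (B t) (z t)) \<le> norm (b n t - B t) * norm (z t)"
        by (simp add: real_adjoint_diff[symmetric] norm_real_adjoint_apply)
      show "(\<lambda>n. norm (b n t - B t) * norm (z t)) \<longlonglongrightarrow> 0"
        using t by (intro tendsto_mult_left_zero tendsto_norm_zero LIM_zero)
    qed
    then show ?thesis unfolding f_def g_def by (intro tendsto_power tendsto_norm)
  qed
  have "(\<lambda>t. if t \<in> N then 0 else f t) \<in> borel_measurable ?M"
  proof (rule borel_measurable_LIMSEQ_metric)
    show "(\<lambda>t. if t \<in> N then 0 else g n t) \<in> borel_measurable ?M" for n
      using N(1) meas_g by (intro measurable_If_set) auto
    show "(\<lambda>n. if t \<in> N then 0 else g n t) \<longlonglongrightarrow> (if t \<in> N then 0 else f t)" if "t \<in> space ?M" for t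
      using N(2) g_lim that by auto
  qed
  then have meas: "(\<lambda>t. if t \<in> N then 0 else f t) \<in> borel_measurable (lebesgue_on {0..r})"
    by (rule measurable_restrict_mono) auto
  have "bounded (z ` {0..r})"
    by (intro compact_imp_bounded compact_continuous_image continuous_on_subset[OF z]) auto
  then obtain m where m: "\<And>t. t \<in> {0..r} \<Longrightarrow> norm (z t) \<le> m" unfolding bounded_iff by blast
  have "(\<lambda>t. if t \<in> N then 0 else f t) integrable_on {0..r}"
  proof (rule measurable_bounded_by_integrable_imp_integrable[OF meas])
    show "(\<lambda>t. (norm (B t))\<^sup>2 * m\<^sup>2) integrable_on {0..r}"
      using B r unfolding L2_loc_def by (intro integrable_on_mult_left) auto
    fix t assume t: "t \<in> {0..r}"
    have "norm (real_adjoint (B t) (z t)) \<le> norm (B t) * m"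
      using norm_real_adjoint_apply mult_left_mono[OF m[OF t] norm_ge_zero] order_trans by blast
    then have "f t \<le> (norm (B t) * m)\<^sup>2" unfolding f_def by (intro power_mono) auto
    then show "norm (if t \<in> N then 0 else f t) \<le> (norm (B t))\<^sup>2 * m\<^sup>2"
      by (simp add: f_def power_mult_distrib)
  qed auto
  moreover have "negligible N"
    using N(1) by (simp add: negligible_iff_null_sets null_sets_restrict_space)
  ultimately have "f integrable_on {0..r}"
    by (rule integrable_spike) auto
  then show ?thesis by (simp add: f_def[abs_def])
qed

text \<open>
  Over a partition on which \<open>\<Phi>\<close> has increments below \<open>e\<close>, the increments of \<open>F\<close> add up to at
  most \<open>e c (\<Phi> r - \<Phi> 0)\<close>. This replaces differentiation: \<open>F\<close> has derivative zero with respect to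
  \<open>\<Phi>\<close>, although neither function need be differentiable in time.
\<close>
lemma constant_if_increments_quadratic:
  fixes F \<Phi> :: "real \<Rightarrow> real"
  assumes "0 \<le> r" "0 \<le> c" and \<Phi>: "continuous_on {0..r} \<Phi>"
    and mono: "\<And>a b. 0 \<le> a \<Longrightarrow> a \<le> b \<Longrightarrow> b \<le> r \<Longrightarrow> \<Phi> a \<le> \<Phi> b"
    and F: "\<And>a b. 0 \<le> a \<Longrightarrow> a \<le> b \<Longrightarrow> b \<le> r \<Longrightarrow> \<bar>F b - F a\<bar> \<le> c * (\<Phi> b - \<Phi> a)\<^sup>2"
  shows "F r = F 0"
proof -
  have small: "\<bar>F r - F 0\<bar> \<le> e * (c * (\<Phi> r - \<Phi> 0))" if "e > 0" for e
  proof -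
    have "uniformly_continuous_on {0..r} \<Phi>" by (intro compact_uniformly_continuous \<Phi>) auto
    then obtain d where d: "d > 0" "\<And>a b. a \<in> {0..r} \<Longrightarrow> b \<in> {0..r} \<Longrightarrow> dist b a < d \<Longrightarrow> dist (\<Phi> b) (\<Phi> a) < e"
      using \<open>e > 0\<close> unfolding uniformly_continuous_on_def by metis
    obtain n where n: "r / d < real n" using reals_Archimedean2 by blast
    have "n > 0" using n \<open>0 \<le> r\<close> d(1) by (cases n) (auto simp: field_simps)
    have step: "r / n < d" using n d(1) \<open>n > 0\<close> by (simp add: field_simps)
    define h where "h = r / n"
    define p where "p i = real i * h" for i
    have p: "0 \<le> p i" "p i \<le> p (Suc i)" "i \<le> n \<Longrightarrow> p i \<le> r" for i
      using \<open>0 \<le> r\<close> \<open>n > 0\<close> mult_left_mono[of "real i" "real n" r] by (auto simp: p_def h_def field_simps)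
    have "\<bar>F (p i) - F 0\<bar> \<le> e * (c * (\<Phi> (p i) - \<Phi> 0))" if "i \<le> n" for i
      using that
    proof (induction i)
      case 0 then show ?case by (simp add: p_def)
    next
      case (Suc i)
      let ?D = "\<Phi> (p (Suc i)) - \<Phi> (p i)"
      have "p (Suc i) - p i < d" using step by (simp add: p_def h_def[symmetric] distrib_right)
      then have "?D < e"
        using d(2)[of "p i" "p (Suc i)"] p[of i] p(1,3)[of "Suc i"] Suc.prems by (auto simp: dist_real_def)
      moreover have "?D \<ge> 0" using mono[of "p i" "p (Suc i)"] p[of i] p(3)[of "Suc i"] Suc.prems by simp
      ultimately have "?D\<^sup>2 \<le> e * ?D"
        unfolding power2_eq_square by (intro mult_right_mono) auto
      then have "c * ?D\<^sup>2 \<le> c * (e * ?D)" using \<open>0 \<le> c\<close> by (rule mult_left_mono)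
      moreover have "\<bar>F (p (Suc i)) - F (p i)\<bar> \<le> c * ?D\<^sup>2"
        using F[of "p i" "p (Suc i)"] p[of i] p(3)[of "Suc i"] Suc.prems by simp
      moreover have "\<bar>F (p i) - F 0\<bar> \<le> e * (c * (\<Phi> (p i) - \<Phi> 0))" using Suc by simp
      ultimately have "\<bar>F (p (Suc i)) - F 0\<bar> \<le> c * (e * ?D) + e * (c * (\<Phi> (p i) - \<Phi> 0))" by linarith
      then show ?case by (simp add: algebra_simps)
    qed
    from this[of n] \<open>n > 0\<close> show ?thesis by (simp add: p_def h_def)
  qed
  have "\<bar>F r - F 0\<bar> \<le> 0"
  proof (rule field_le_epsilon)
    fix e :: real assume "e > 0"
    define K where "K = c * (\<Phi> r - \<Phi> 0)"
    have "K \<ge> 0" using mono[of 0 r] \<open>0 \<le> c\<close> \<open>0 \<le> r\<close> by (simp add: K_def)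
    have "\<bar>F r - F 0\<bar> \<le> e / (K + 1) * K"
      using small[of "e / (K + 1)"] \<open>e > 0\<close> \<open>K \<ge> 0\<close> by (simp add: K_def)
    also have "\<dots> \<le> e" using \<open>e > 0\<close> \<open>K \<ge> 0\<close> by (simp add: field_simps)
    finally show "\<bar>F r - F 0\<bar> \<le> 0 + e" by simp
  qed
  then show ?thesis by simp
qed

section \<open>Mild solutions of the damped system\<close>

text \<open>
  The damping \<open>B(t)B(t)\<^sup>*\<close> enters the estimates only through \<open>C(t) = B(t)\<^sup>*\<close>, and the size of \<open>C(t)\<close>
  only through the locally integrable function \<open>\<beta>\<close>.
\<close>
locale damped_rotation =
  fixes R :: "real \<Rightarrow> 'a::{real_inner,banach} \<Rightarrow>\<^sub>L 'a"
    and C :: "real \<Rightarrow> 'a \<Rightarrow>\<^sub>L 'v::real_inner"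
    and \<beta> :: "real \<Rightarrow> real" and \<tau> :: real
  assumes R_inner: "R t x \<bullet> R t y = x \<bullet> y"
    and R_add: "R (s + t) x = R s (R t x)"
    and R_zero: "R 0 x = x"
    and R_cont: "continuous_on UNIV (\<lambda>t. R t x)"
    and R_period: "R \<tau> x = x"
    and tau_pos: "0 < \<tau>"
    and beta_nonneg: "0 \<le> \<beta> t"
    and beta_integrable: "0 \<le> r \<Longrightarrow> \<beta> integrable_on {0..r}"
    and C_bound: "0 \<le> t \<Longrightarrow> (norm (C t y))\<^sup>2 \<le> \<beta> t * (norm y)\<^sup>2"
    and C_integrable: "continuous_on {0..} z \<Longrightarrow> 0 \<le> r \<Longrightarrow> (\<lambda>t. (norm (C t (z t)))\<^sup>2) integrable_on {0..r}"
    and C_period: "\<exists>N. negligible N \<and> (\<forall>t\<in>{0..} - N. C (t + \<tau>) = C t)"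
begin

text \<open>
  This is the variation-of-constants formula tested against \<open>R(t)y\<close>, with \<open>R(t - s)\<close> moved onto the
  test vector. All integrals have become scalar.
\<close>
definition weak_solution :: "'a \<Rightarrow> (real \<Rightarrow> 'a) \<Rightarrow> bool" where
  "weak_solution x z \<longleftrightarrow> continuous_on {0..} z \<and>
     (\<forall>t\<ge>0. \<forall>y. ((\<lambda>s. C s (z s) \<bullet> C s (R s y)) has_integral (x \<bullet> y - z t \<bullet> R t y)) {0..t})"

lemma norm_R: "norm (R t x) = norm x"
  by (simp add: norm_eq_sqrt_inner R_inner)

lemma R_uminus: "R t (R (- t) x) = x"
  by (metis R_add R_zero add.right_inverse)

lemma weak_solution_if_mild:
  fixes B :: "real \<Rightarrow> 'v \<Rightarrow>\<^sub>L 'a"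
  assumes z: "continuous_on {0..} z"
    and adj: "\<And>s u y. 0 \<le> s \<Longrightarrow> B s u \<bullet> y = u \<bullet> C s y"
    and mild: "\<And>t. 0 \<le> t \<Longrightarrow> ((\<lambda>s. R (t - s) (B s (C s (z s)))) has_integral (R t x - z t)) {0..t}"
  shows "weak_solution x z"
  unfolding weak_solution_def
proof (intro conjI allI impI)
  fix t y assume t: "0 \<le> (t::real)"
  have "((\<lambda>s. R (t - s) (B s (C s (z s))) \<bullet> R t y) has_integral (R t x - z t) \<bullet> R t y) {0..t}"
    using has_integral_linear[OF mild[OF t] bounded_linear_inner_left[of "R t y"]] by (simp add: comp_def)
  moreover have "R (t - s) (B s (C s (z s))) \<bullet> R t y = C s (z s) \<bullet> C s (R s y)" if "s \<in> {0..t}" for s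
    using adj[of s "C s (z s)" "R s y"] that R_inner[of "t - s" "B s (C s (z s))" "R s y"] R_add[of "t - s" s y]
    by simp
  ultimately have "((\<lambda>s. C s (z s) \<bullet> C s (R s y)) has_integral (R t x - z t) \<bullet> R t y) {0..t}"
    by (rule has_integral_eq[rotated])
  then show "((\<lambda>s. C s (z s) \<bullet> C s (R s y)) has_integral (x \<bullet> y - z t \<bullet> R t y)) {0..t}"
    by (simp add: inner_diff_left R_inner)
qed (rule z)

lemma C_inner_bound:
  assumes "0 \<le> s" "norm u \<le> m"
  shows "\<bar>C s u \<bullet> C s (R s y)\<bar> \<le> \<beta> s * (m * norm y)"
proof -
  have root: "norm (C s v) \<le> sqrt (\<beta> s) * norm v" for v
    using real_sqrt_le_mono[OF C_bound[OF assms(1), of v]] by (simp add: real_sqrt_mult)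
  have "\<bar>C s u \<bullet> C s (R s y)\<bar> \<le> norm (C s u) * norm (C s (R s y))" by (rule Cauchy_Schwarz_ineq2)
  also have "\<dots> \<le> (sqrt (\<beta> s) * norm u) * (sqrt (\<beta> s) * norm y)"
    using root[of u] root[of "R s y"] beta_nonneg[of s] by (intro mult_mono) (auto simp: norm_R)
  also have "\<dots> = (sqrt (\<beta> s) * sqrt (\<beta> s)) * (norm u * norm y)" by (simp only: mult_ac)
  also have "\<dots> = \<beta> s * (norm u * norm y)" using beta_nonneg[of s] by simp
  also have "\<dots> \<le> \<beta> s * (m * norm y)"
    using assms(2) beta_nonneg[of s] by (intro mult_left_mono mult_right_mono) auto
  finally show ?thesis .
qed

lemma has_integral_increment:
  fixes f :: "real \<Rightarrow> real"
  assumes "0 \<le> a" "a \<le> b" "(f has_integral I) {0..a}" "(f has_integral J) {0..b}"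
  shows "(f has_integral (J - I)) {a..b}"
proof -
  have "f integrable_on {a..b}"
    by (rule integrable_subinterval_real[of f 0 b]) (use assms in \<open>auto simp: integrable_on_def\<close>)
  then obtain K where K: "(f has_integral K) {a..b}" by (auto simp: integrable_on_def)
  have "(f has_integral (I + K)) {0..b}"
    using has_integral_combine[OF assms(1,2,3) K] .
  then have "I + K = J" using assms(4) has_integral_unique by blast
  then show ?thesis using K by (auto simp: algebra_simps)
qed

text \<open>
  In the rotating frame \<open>w(t) = R(-t) z(t)\<close> one has formally \<open>w' = - R(-t) C(t)\<^sup>* C(t) z(t)\<close>, so that
  \<open>\<parallel>w\<parallel>\<^sup>2\<close> has derivative \<open>- 2 \<parallel>C z\<parallel>\<^sup>2\<close>. Since only the integrated form is available, the increment of
  \<open>F(t) = \<parallel>w(t)\<parallel>\<^sup>2 + 2 \<integral>\<^sub>0\<^sup>t \<parallel>C z\<parallel>\<^sup>2\<close> over \<open>[a,b]\<close> is written as an integral in which \<open>2 w(s)\<close> is compared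
  with \<open>w(a) + w(b)\<close>. As \<open>w\<close> is Lipschitz with respect to \<open>\<Phi>(t) = \<integral>\<^sub>0\<^sup>t \<beta>\<close>, that increment is quadratic
  in \<open>\<Phi>(b) - \<Phi>(a)\<close>.
\<close>
lemma energy_identity:
  assumes z: "weak_solution x z" and r: "0 \<le> r"
  shows "((\<lambda>s. (norm (C s (z s)))\<^sup>2) has_integral ((norm x)\<^sup>2 - (norm (z r))\<^sup>2) / 2) {0..r}"
proof -
  have cont: "continuous_on {0..} z"
    and weak: "\<And>t y. 0 \<le> t \<Longrightarrow> ((\<lambda>s. C s (z s) \<bullet> C s (R s y)) has_integral (x \<bullet> y - z t \<bullet> R t y)) {0..t}"
    using z unfolding weak_solution_def by blast+
  define w where "w t = R (- t) (z t)" for t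
  have Rw: "R t (w t) = z t" for t by (simp add: w_def R_uminus)
  have w_inner: "z t \<bullet> R t y = w t \<bullet> y" for t y using R_inner[of t "w t" y] by (simp add: Rw)
  have "bounded (z ` {0..r})"
    by (intro compact_imp_bounded compact_continuous_image continuous_on_subset[OF cont]) auto
  then obtain m where m: "\<And>t. t \<in> {0..r} \<Longrightarrow> norm (z t) \<le> m" unfolding bounded_iff by blast
  have "0 \<le> m" using order_trans[OF norm_ge_zero m[of 0]] r by simp
  define \<Phi> where "\<Phi> t = integral {0..t} \<beta>" for t
  have \<Phi>_int: "(\<beta> has_integral (\<Phi> b - \<Phi> a)) {a..b}" if "0 \<le> a" "a \<le> b" for a b
    using that beta_integrable unfolding \<Phi>_def
    by (intro has_integral_increment) (auto intro: integrable_integral)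
  have \<Phi>_mono: "\<Phi> a \<le> \<Phi> b" if "0 \<le> a" "a \<le> b" for a b
    using has_integral_nonneg[OF \<Phi>_int[OF that]] beta_nonneg by simp
  have weak_ab: "((\<lambda>s. C s (z s) \<bullet> C s (R s y)) has_integral ((w a - w b) \<bullet> y)) {a..b}"
    if "0 \<le> a" "a \<le> b" for a b y
  proof -
    have "((\<lambda>s. C s (z s) \<bullet> C s (R s y)) has_integral
        ((x \<bullet> y - z b \<bullet> R b y) - (x \<bullet> y - z a \<bullet> R a y))) {a..b}"
      using that by (intro has_integral_increment weak) auto
    then show ?thesis by (simp add: w_inner inner_diff_left)
  qed
  have w_lip: "norm (w a - w b) \<le> m * (\<Phi> b - \<Phi> a)" if "0 \<le> a" "a \<le> b" "b \<le> r" for a b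
  proof -
    let ?y = "w a - w b"
    have "?y \<bullet> ?y \<le> (\<Phi> b - \<Phi> a) * (m * norm ?y)"
    proof (rule has_integral_le[OF weak_ab[OF that(1,2)] has_integral_mult_left[OF \<Phi>_int[OF that(1,2)]]])
      show "C s (z s) \<bullet> C s (R s ?y) \<le> \<beta> s * (m * norm ?y)" if "s \<in> {a..b}" for s
        using C_inner_bound[of s "z s" m ?y] m[of s] that \<open>0 \<le> a\<close> \<open>b \<le> r\<close> by auto
    qed
    then have "norm ?y * norm ?y \<le> norm ?y * (m * (\<Phi> b - \<Phi> a))"
      by (simp add: power2_norm_eq_inner[symmetric] power2_eq_square algebra_simps)
    then show ?thesis
      using \<Phi>_mono[OF that(1,2)] \<open>0 \<le> m\<close>
      by (cases "norm ?y = 0") (auto simp: mult_le_cancel_left)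
  qed
  define E where "E t = integral {0..t} (\<lambda>s. (norm (C s (z s)))\<^sup>2)" for t
  have E: "((\<lambda>s. (norm (C s (z s)))\<^sup>2) has_integral E t) {0..t}" if "0 \<le> t" for t
    unfolding E_def using C_integrable[OF cont that] by (rule integrable_integral)
  define F where "F t = (norm (w t))\<^sup>2 + 2 * E t" for t
  have "F r = F 0"
  proof (rule constant_if_increments_quadratic[where \<Phi> = \<Phi> and c = "2 * m\<^sup>2"])
    show "continuous_on {0..r} \<Phi>"
      unfolding \<Phi>_def by (intro indefinite_integral_continuous_1 beta_integrable r)
  next
    fix a b assume ab: "0 \<le> a" "a \<le> b" "b \<le> r"
    have "((\<lambda>s. 2 * (norm (C s (z s)))\<^sup>2 - C s (z s) \<bullet> C s (R s (w a + w b)))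
        has_integral (2 * (E b - E a) - (w a - w b) \<bullet> (w a + w b))) {a..b}"
      using ab E by (intro has_integral_diff has_integral_mult_right has_integral_increment weak_ab) auto
    moreover have "2 * (E b - E a) - (w a - w b) \<bullet> (w a + w b) = F b - F a"
      by (simp add: F_def power2_norm_eq_inner inner_diff_left inner_add_right inner_commute algebra_simps)
    ultimately have int: "((\<lambda>s. 2 * (norm (C s (z s)))\<^sup>2 - C s (z s) \<bullet> C s (R s (w a + w b)))
        has_integral (F b - F a)) {a..b}" by simp
    have dom: "((\<lambda>s. \<beta> s * (m * (2 * m * (\<Phi> b - \<Phi> a)))) has_integral
        (\<Phi> b - \<Phi> a) * (m * (2 * m * (\<Phi> b - \<Phi> a)))) {a..b}"
      by (intro has_integral_mult_left \<Phi>_int ab)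
    have bound: "\<bar>2 * (norm (C s (z s)))\<^sup>2 - C s (z s) \<bullet> C s (R s (w a + w b))\<bar>
        \<le> \<beta> s * (m * (2 * m * (\<Phi> b - \<Phi> a)))" if s: "s \<in> {a..b}" for s
    proof -
      let ?y = "(w s - w b) - (w a - w s)"
      have "2 * (norm (C s (z s)))\<^sup>2 - C s (z s) \<bullet> C s (R s (w a + w b)) = C s (z s) \<bullet> C s (R s ?y)"
        by (simp add: Rw[symmetric] power2_norm_eq_inner blinfun.diff_right blinfun.add_right
            inner_diff_right inner_add_right)
      also have "\<bar>\<dots>\<bar> \<le> \<beta> s * (m * norm ?y)"
        using m[of s] s ab by (intro C_inner_bound) auto
      also have "\<dots> \<le> \<beta> s * (m * (2 * m * (\<Phi> b - \<Phi> a)))"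
      proof (intro mult_left_mono)
        have "norm ?y \<le> norm (w s - w b) + norm (w a - w s)" by (rule norm_triangle_ineq4)
        also have "\<dots> \<le> m * (\<Phi> b - \<Phi> s) + m * (\<Phi> s - \<Phi> a)"
          using s ab by (intro add_mono w_lip) auto
        also have "\<dots> \<le> 2 * m * (\<Phi> b - \<Phi> a)"
          using \<open>0 \<le> m\<close> \<Phi>_mono[OF ab(1,2)] by (simp add: algebra_simps mult_left_mono)
        finally show "norm ?y \<le> 2 * m * (\<Phi> b - \<Phi> a)" .
      qed (use \<open>0 \<le> m\<close> beta_nonneg in auto)
      finally show ?thesis .
    qed
    have "F b - F a \<le> (\<Phi> b - \<Phi> a) * (m * (2 * m * (\<Phi> b - \<Phi> a)))"
      by (rule has_integral_le[OF int dom]) (use bound in fastforce)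
    moreover have "- (F b - F a) \<le> (\<Phi> b - \<Phi> a) * (m * (2 * m * (\<Phi> b - \<Phi> a)))"
      by (rule has_integral_le[OF has_integral_neg[OF int] dom]) (use bound in fastforce)
    ultimately show "\<bar>F b - F a\<bar> \<le> 2 * m\<^sup>2 * (\<Phi> b - \<Phi> a)\<^sup>2"
      by (simp add: power2_eq_square algebra_simps)
  qed (use r \<Phi>_mono in auto)
  moreover have "w 0 = x"
  proof (rule vector_eq_ldot[THEN iffD1], rule allI)
    fix y
    have "x \<bullet> y - z 0 \<bullet> R 0 y = 0" 
      using has_integral_unique[OF weak[of 0 y], of 0] by (simp add: has_integral_refl(2))
    then show "y \<bullet> w 0 = y \<bullet> x" by (simp add: w_inner inner_commute)
  qed
  moreover have "norm (w r) = norm (z r)" by (simp add: w_def norm_R)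
  moreover have "E 0 = 0" by (simp add: E_def)
  ultimately have Er: "E r = ((norm x)\<^sup>2 - (norm (z r))\<^sup>2) / 2" by (simp add: F_def)
  show ?thesis using E[OF r] unfolding Er .
qed

lemma weak_solution_diff:
  assumes "weak_solution x z" "weak_solution x' z'"
  shows "weak_solution (x - x') (\<lambda>t. z t - z' t)"
  unfolding weak_solution_def
proof (intro conjI allI impI)
  show "continuous_on {0..} (\<lambda>t. z t - z' t)"
    using assms unfolding weak_solution_def by (auto intro: continuous_intros)
  fix t y assume "0 \<le> (t::real)"
  then have "((\<lambda>s. C s (z s) \<bullet> C s (R s y) - C s (z' s) \<bullet> C s (R s y)) has_integral
      ((x \<bullet> y - z t \<bullet> R t y) - (x' \<bullet> y - z' t \<bullet> R t y))) {0..t}"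
    using assms unfolding weak_solution_def by (intro has_integral_diff) auto
  then show "((\<lambda>s. C s (z s - z' s) \<bullet> C s (R s y)) has_integral
      ((x - x') \<bullet> y - (z t - z' t) \<bullet> R t y)) {0..t}"
    by (simp add: blinfun.diff_right inner_diff_left algebra_simps)
qed

text \<open>
  The difference of two solutions starts at zero, and by the energy identity its norm cannot grow.
\<close>
lemma weak_solution_unique:
  assumes "weak_solution x z" "weak_solution x z'" "0 \<le> t"
  shows "z t = z' t"
proof -
  have "((\<lambda>s. (norm (C s (z s - z' s)))\<^sup>2) has_integral (0 - (norm (z t - z' t))\<^sup>2) / 2) {0..t}"
    using energy_identity[OF weak_solution_diff[OF assms(1,2)] assms(3)] by simp
  from has_integral_nonneg[OF this] show ?thesis by simp
qed

text \<open>
  Subtracting the defining identities at times \<open>t + \<tau>\<close> and \<open>\<tau>\<close> leaves an integral over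
  \<open>[\<tau>, t + \<tau>]\<close>, which periodicity of \<open>C\<close> and of \<open>R\<close> moves back to \<open>[0,t]\<close>.
\<close>
lemma weak_solution_shift:
  assumes z: "weak_solution x z"
  shows "weak_solution (z \<tau>) (\<lambda>t. z (t + \<tau>))"
  unfolding weak_solution_def
proof (intro conjI allI impI)
  show "continuous_on {0..} (\<lambda>t. z (t + \<tau>))"
  proof (rule continuous_on_compose2[of "{0..}" z])
    show "continuous_on {0..} z" using z unfolding weak_solution_def by blast
    show "continuous_on {0..} (\<lambda>t. t + \<tau>)" by (intro continuous_intros)
    show "(\<lambda>t. t + \<tau>) ` {0..} \<subseteq> {0..}" using tau_pos by auto
  qed
  fix t y assume t: "0 \<le> (t::real)"
  obtain N where N: "negligible N" "\<And>t. t \<in> {0..} - N \<Longrightarrow> C (t + \<tau>) = C t"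
    using C_period by blast
  have Rt: "R (s + \<tau>) y = R s y" for s y by (simp add: R_add R_period)
  have "((\<lambda>s. C s (z s) \<bullet> C s (R s y)) has_integral
      ((x \<bullet> y - z (t + \<tau>) \<bullet> R (t + \<tau>) y) - (x \<bullet> y - z \<tau> \<bullet> R \<tau> y))) {\<tau>..t + \<tau>}"
    by (rule has_integral_increment) (use z t tau_pos in \<open>auto simp: weak_solution_def\<close>)
  then have "((\<lambda>s. C s (z s) \<bullet> C s (R s y)) has_integral (z \<tau> \<bullet> y - z (t + \<tau>) \<bullet> R t y)) {\<tau>..t + \<tau>}"
    by (simp add: Rt R_period)
  from has_integral_shift_real_ivl[OF this, of \<tau>]
  have "((\<lambda>s. C (s + \<tau>) (z (s + \<tau>)) \<bullet> C (s + \<tau>) (R s y)) has_integral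
      (z \<tau> \<bullet> y - z (t + \<tau>) \<bullet> R t y)) {0..t}" by (simp add: Rt)
  then show "((\<lambda>s. C s (z (s + \<tau>)) \<bullet> C s (R s y)) has_integral (z \<tau> \<bullet> y - z (t + \<tau>) \<bullet> R t y)) {0..t}"
    by (rule has_integral_spike[OF N(1), rotated]) (use N(2) in auto)
qed

definition energy :: "'a \<Rightarrow> real" where
  "energy x = integral {0..\<tau>} (\<lambda>t. (norm (C t (R t x)))\<^sup>2)"

lemma energy_has_integral: "((\<lambda>t. (norm (C t (R t x)))\<^sup>2) has_integral energy x) {0..\<tau>}"
  unfolding energy_def using tau_pos
  by (intro integrable_integral C_integrable continuous_on_subset[OF R_cont]) auto

lemma energy_nonneg: "0 \<le> energy x"
  using has_integral_nonneg[OF energy_has_integral] by simp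

text \<open>
  Let \<open>E\<close> be the energy dissipated over one period. Cauchy-Schwarz in the defining identity gives the
  bound with \<open>E\<close> in place of \<open>energy x\<close>. Taking \<open>y = x\<close> and using \<open>E \<le> \<langle>x - z(\<tau>), x\<rangle>\<close>, the same bound
  reads \<open>E\<^sup>2 \<le> E energy x\<close>, so that \<open>E \<le> energy x\<close>.
\<close>
lemma monodromy_form_bound:
  assumes z: "weak_solution x z"
  shows "((x - z \<tau>) \<bullet> y)\<^sup>2 \<le> energy x * energy y"
proof -
  define E where "E = ((norm x)\<^sup>2 - (norm (z \<tau>))\<^sup>2) / 2"
  have E: "((\<lambda>s. (norm (C s (z s)))\<^sup>2) has_integral E) {0..\<tau>}"
    unfolding E_def using energy_identity[OF z] tau_pos by simp
  have "0 \<le> E" using has_integral_nonneg[OF E] by simp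
  have *: "((x - z \<tau>) \<bullet> y)\<^sup>2 \<le> E * energy y" for y
  proof (rule has_integral_Cauchy_Schwarz[OF _ E energy_has_integral])
    show "((\<lambda>s. C s (z s) \<bullet> C s (R s y)) has_integral ((x - z \<tau>) \<bullet> y)) {0..\<tau>}"
      using z tau_pos unfolding weak_solution_def by (auto simp: inner_diff_left R_period dest: spec[of _ \<tau>])
    show "0 \<le> (norm (C s (z s)))\<^sup>2 \<and> 0 \<le> (norm (C s (R s y)))\<^sup>2 \<and>
        (C s (z s) \<bullet> C s (R s y))\<^sup>2 \<le> (norm (C s (z s)))\<^sup>2 * (norm (C s (R s y)))\<^sup>2" for s
      using Cauchy_Schwarz_ineq by (auto simp: power2_norm_eq_inner)
  qed
  have "E \<le> (x - z \<tau>) \<bullet> x"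
    using zero_le_power2[of "norm (x - z \<tau>)"]
    unfolding E_def power2_norm_eq_inner by (simp add: inner_diff_left inner_diff_right inner_commute)
  then have "E\<^sup>2 \<le> ((x - z \<tau>) \<bullet> x)\<^sup>2" using \<open>0 \<le> E\<close> by (intro power_mono)
  also have "\<dots> \<le> E * energy x" by (rule *)
  finally have "E \<le> energy x"
    using \<open>0 \<le> E\<close> energy_nonneg[of x] by (cases "E = 0") (auto simp: power2_eq_square)
  then have "E * energy y \<le> energy x * energy y" using energy_nonneg by (rule mult_right_mono)
  then show ?thesis using *[of y] by linarith
qed

definition beta_mass :: real where "beta_mass = integral {0..\<tau>} \<beta>"

text \<open>
  The free and the damped motion differ by at most \<open>sqrt (E beta_mass)\<close> in norm over one period, where \<open>E\<close>
  is the dissipated energy. Hence observing the free motion sees no more than a multiple of \<open>E\<close>.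
\<close>
lemma energy_le_dissipation:
  assumes z: "weak_solution x z"
  shows "energy x \<le> (1 + beta_mass\<^sup>2) * ((norm x)\<^sup>2 - (norm (z \<tau>))\<^sup>2)"
proof -
  have cont: "continuous_on {0..} z" using z unfolding weak_solution_def by blast
  define E where "E = ((norm x)\<^sup>2 - (norm (z \<tau>))\<^sup>2) / 2"
  have E: "((\<lambda>s. (norm (C s (z s)))\<^sup>2) has_integral E) {0..\<tau>}"
    unfolding E_def using energy_identity[OF z] tau_pos by simp
  have L: "(\<beta> has_integral beta_mass) {0..\<tau>}"
    unfolding beta_mass_def using beta_integrable tau_pos by (intro integrable_integral) auto
  have "0 \<le> E" using has_integral_nonneg[OF E] by simp
  have "0 \<le> beta_mass" using has_integral_nonneg[OF L] beta_nonneg by simp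
  have dev: "(norm (R t x - z t))\<^sup>2 \<le> E * beta_mass" if t: "t \<in> {0..\<tau>}" for t
  proof -
    define y where "y = R (- t) (R t x - z t)"
    have Ry: "R t y = R t x - z t" by (simp add: y_def R_uminus)
    have ny: "norm y = norm (R t x - z t)" by (simp add: y_def norm_R)
    let ?E = "integral {0..t} (\<lambda>s. (norm (C s (z s)))\<^sup>2)" and ?L = "integral {0..t} \<beta>"
    have "((x \<bullet> y - z t \<bullet> R t y))\<^sup>2 \<le> ?E * (?L * (norm y)\<^sup>2)"
    proof (rule has_integral_Cauchy_Schwarz)
      show "((\<lambda>s. C s (z s) \<bullet> C s (R s y)) has_integral (x \<bullet> y - z t \<bullet> R t y)) {0..t}"
        using z t unfolding weak_solution_def by auto
      show "((\<lambda>s. (norm (C s (z s)))\<^sup>2) has_integral ?E) {0..t}"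
        using C_integrable[OF cont] t by (intro integrable_integral) auto
      show "((\<lambda>s. \<beta> s * (norm y)\<^sup>2) has_integral ?L * (norm y)\<^sup>2) {0..t}"
        using beta_integrable t by (intro has_integral_mult_left integrable_integral) auto
      fix s assume s: "s \<in> {0..t}"
      have "(C s (z s) \<bullet> C s (R s y))\<^sup>2 \<le> (norm (C s (z s)))\<^sup>2 * (norm (C s (R s y)))\<^sup>2"
        using Cauchy_Schwarz_ineq by (auto simp: power2_norm_eq_inner)
      also have "\<dots> \<le> (norm (C s (z s)))\<^sup>2 * (\<beta> s * (norm y)\<^sup>2)"
        using C_bound[of s "R s y"] s by (intro mult_left_mono) (auto simp: norm_R)
      finally show "0 \<le> (norm (C s (z s)))\<^sup>2 \<and> 0 \<le> \<beta> s * (norm y)\<^sup>2 \<and>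
          (C s (z s) \<bullet> C s (R s y))\<^sup>2 \<le> (norm (C s (z s)))\<^sup>2 * (\<beta> s * (norm y)\<^sup>2)"
        using beta_nonneg[of s] by simp
    qed
    also have "\<dots> \<le> E * (beta_mass * (norm y)\<^sup>2)"
    proof (intro mult_mono mult_right_mono)
      show "?E \<le> E" using t C_integrable[OF cont] E
        by (subst integral_unique[OF E, symmetric], intro integral_subset_le) (auto intro: integrable_integral simp: integrable_on_def)
      show "?L \<le> beta_mass" using t beta_integrable beta_nonneg unfolding beta_mass_def
        by (intro integral_subset_le) auto
      show "0 \<le> ?L * (norm y)\<^sup>2" using beta_nonneg beta_integrable t by (intro mult_nonneg_nonneg integral_nonneg) auto
    qed (use \<open>0 \<le> E\<close> \<open>0 \<le> beta_mass\<close> in auto)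
    finally have "(x \<bullet> y - z t \<bullet> R t y)\<^sup>2 \<le> E * beta_mass * (norm y)\<^sup>2" by (simp add: mult.assoc)
    moreover have "x \<bullet> y - z t \<bullet> R t y = (norm y)\<^sup>2"
    proof -
      have "x \<bullet> y = R t x \<bullet> R t y" by (simp add: R_inner)
      then have "x \<bullet> y - z t \<bullet> R t y = R t y \<bullet> R t y" by (simp add: Ry inner_diff_left inner_diff_right)
      then show ?thesis by (simp add: R_inner power2_norm_eq_inner)
    qed
    ultimately have le: "(norm y)\<^sup>2 * (norm y)\<^sup>2 \<le> E * beta_mass * (norm y)\<^sup>2"
      by (simp only: power2_eq_square[of "(norm y)\<^sup>2"])
    have "(norm y)\<^sup>2 \<le> E * beta_mass \<or> norm y = 0"
    proof (cases "norm y = 0")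
      case False
      then show ?thesis using mult_right_le_imp_le[OF le] by simp
    qed simp
    moreover have "0 \<le> E * beta_mass" using \<open>0 \<le> E\<close> \<open>0 \<le> beta_mass\<close> by simp
    ultimately show ?thesis by (auto simp: ny)
  qed
  have "energy x \<le> 2 * E + beta_mass * (2 * (E * beta_mass))"
  proof (rule has_integral_le[OF energy_has_integral
        has_integral_add[OF has_integral_mult_right[OF E] has_integral_mult_left[OF L]]])
    fix s assume s: "s \<in> {0..\<tau>}"
    let ?a = "C s (z s)" and ?b = "C s (R s x - z s)"
    have "(norm (C s (R s x)))\<^sup>2 = (norm (?a + ?b))\<^sup>2" by (simp add: blinfun.diff_right)
    also have "\<dots> \<le> 2 * (norm ?a)\<^sup>2 + 2 * (norm ?b)\<^sup>2"
      using zero_le_power2[of "norm (?a - ?b)"]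
      by (simp add: power2_norm_eq_inner algebra_simps inner_commute)
    also have "(norm ?b)\<^sup>2 \<le> \<beta> s * (E * beta_mass)"
      using C_bound[of s "R s x - z s"] mult_left_mono[OF dev[OF s] beta_nonneg[of s]] s by simp
    finally show "(norm (C s (R s x)))\<^sup>2 \<le> 2 * (norm ?a)\<^sup>2 + \<beta> s * (2 * (E * beta_mass))" by simp
  qed
  then show ?thesis by (simp add: E_def field_simps power2_eq_square)
qed

end

lemma damped_rotation_of_contraction_family:
  fixes B :: "real \<Rightarrow> 'v::complex_hilbert \<Rightarrow>\<^sub>L 'x::complex_hilbert"
  assumes T0: "unitary_group T0" and B: "\<And>t. t \<ge> 0 \<Longrightarrow> clinear (B t)" "L2_loc B"
    and \<tau>: "\<tau> > 0" "AE t in lebesgue_on {0..}. B (t + \<tau>) = B t" "T0 \<tau> = id_blinfun"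
  shows "damped_rotation T0 (\<lambda>t. cadjoint (B t)) (\<lambda>t. (norm (B t))\<^sup>2) \<tau>"
proof
  fix s t r :: real and x y :: 'x
  show "T0 t x \<bullet> T0 t y = x \<bullet> y" using T0 by (simp add: unitary_group_def inner_eq_Re_cinner)
  show "T0 (s + t) x = T0 s (T0 t x)" using T0 by (simp add: unitary_group_def)
  show "T0 0 x = x" using T0 by (simp add: unitary_group_def)
  show "continuous_on UNIV (\<lambda>t. T0 t x)" using T0 by (simp add: unitary_group_def)
  show "T0 \<tau> x = x" using \<tau>(3) by simp
  show "0 < \<tau>" by fact
  show "0 \<le> (norm (B t))\<^sup>2" by simp
  show "(\<lambda>t. (norm (B t))\<^sup>2) integrable_on {0..r}" if "0 \<le> r"
    using B(2) that by (simp add: L2_loc_def)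
  show "(norm (cadjoint (B t) y))\<^sup>2 \<le> (norm (B t))\<^sup>2 * (norm y)\<^sup>2" if "0 \<le> t"
    using power_mono[OF norm_real_adjoint_apply[of "B t" y] norm_ge_zero, of 2] cadjoint_eq_real_adjoint[OF B(1)[OF that]]
    by (simp add: power_mult_distrib)
  show "(\<lambda>t. (norm (cadjoint (B t) (z t)))\<^sup>2) integrable_on {0..r}"
    if "continuous_on {0..} z" "0 \<le> r" for z
    by (rule integrable_eq[OF real_adjoint_energy_integrable[OF B(2) that]])
       (simp add: cadjoint_eq_real_adjoint[OF B(1)])
  obtain N where N: "N \<in> null_sets (lebesgue_on {0..})"
    "{t \<in> space (lebesgue_on {0..}). B (t + \<tau>) \<noteq> B t} \<subseteq> N"
    using \<tau>(2) unfolding eventually_ae_filter by blast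
  have "negligible N"
    using N(1) by (simp add: negligible_iff_null_sets null_sets_restrict_space)
  then show "\<exists>N. negligible N \<and> (\<forall>t\<in>{0..} - N. cadjoint (B (t + \<tau>)) = cadjoint (B t))"
    using N(2) by (intro exI[of _ N]) auto
qed

section \<open>Iterates of bounded operators\<close>

lemma bounded_linear_funpow:
  fixes f :: "'a::real_normed_vector \<Rightarrow> 'a"
  assumes "bounded_linear f"
  shows "bounded_linear (f ^^ n)"
proof (induction n)
  case 0 then show ?case by (simp add: id_def bounded_linear_ident)
next
  case (Suc n) then show ?case using bounded_linear_compose[OF assms] by (simp add: comp_def)
qed

lemma funpow_commute:
  assumes "\<And>x. f (g x) = g (f x)"
  shows "(f ^^ n) ((g ^^ m) x) = (g ^^ m) ((f ^^ n) x)"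
proof -
  have "f ((g ^^ m) x) = (g ^^ m) (f x)" for x by (induction m) (simp_all add: assms)
  then show ?thesis by (induction n) simp_all
qed

lemma convergent_if_increments_geometric:
  fixes X :: "nat \<Rightarrow> 'a::banach"
  assumes "\<And>k. norm (X (Suc k) - X k) \<le> c * (1/2) ^ k"
  obtains l where "X \<longlonglongrightarrow> l" "norm (l - X 0) \<le> 2 * c"
proof -
  let ?d = "\<lambda>k. X (Suc k) - X k"
  have geo: "(\<lambda>k. c * (1/2::real) ^ k) sums (c * 2)"
    using sums_mult[OF geometric_sums[of "1/2::real"]] by simp
  have norms: "summable (\<lambda>k. norm (?d k))"
    by (rule summable_comparison_test[OF _ sums_summable[OF geo]]) (use assms in auto)
  then have "(\<lambda>n. X 0 + (\<Sum>k<n. ?d k)) \<longlonglongrightarrow> X 0 + suminf ?d"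
    by (intro tendsto_add tendsto_const summable_LIMSEQ[OF summable_norm_cancel[OF norms]])
  then have "X \<longlonglongrightarrow> X 0 + suminf ?d" by (simp add: sum_lessThan_telescope)
  moreover have "norm (X 0 + suminf ?d - X 0) \<le> 2 * c"
    using summable_norm[OF norms] suminf_le[OF assms norms sums_summable[OF geo]] sums_unique[OF geo]
    by simp
  ultimately show ?thesis using that by blast
qed

text \<open>
  Choose \<open>u\<^sub>0 = z\<close> and then \<open>u\<^sub>k\<^sub>+\<^sub>1\<close> with \<open>S u\<^sub>k\<^sub>+\<^sub>1\<close> so close to \<open>u\<^sub>k\<close> that \<open>S\<^sup>k u\<^sub>j\<^sub>+\<^sub>k\<close> converges as
  \<open>k\<close> grows, for every \<open>j\<close>. The limits \<open>v\<^sub>j\<close> satisfy \<open>S v\<^sub>j\<^sub>+\<^sub>1 = v\<^sub>j\<close>, so \<open>v\<^sub>0\<close> lies in the range of every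
  power of \<open>S\<close>, and it is close to \<open>z\<close>.
\<close>
lemma mittag_leffler_dense:
  fixes S :: "'a::banach \<Rightarrow>\<^sub>L 'a"
  assumes dense: "\<And>z e. z \<in> Z \<Longrightarrow> 0 < e \<Longrightarrow> \<exists>v\<in>Z. norm (z - S v) < e"
    and z: "z \<in> Z" and e: "0 < e"
  shows "\<exists>w. norm (w - z) < e \<and> (\<forall>k. \<exists>v. w = (blinfun_apply S ^^ k) v)"
proof -
  define L where "L = 1 + norm S"
  have "L \<ge> 1" by (simp add: L_def)
  \<comment> \<open>The factor \<open>L ^ k\<close> absorbs the norm of \<open>S ^ k\<close>, the factor \<open>2 ^ k\<close> makes the errors summable.\<close>
  define \<epsilon> where "\<epsilon> k = e / 4 / (2 * L) ^ k" for k
  have \<epsilon>_pos: "0 < \<epsilon> k" for k using e \<open>L \<ge> 1\<close> by (simp add: \<epsilon>_def)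
  have "\<exists>u. u 0 = z \<and> (\<forall>k. u k \<in> Z \<and> norm (u k - S (u (Suc k))) < \<epsilon> k)"
  proof -
    have "\<exists>u. \<forall>k. (u k \<in> Z \<and> (k = 0 \<longrightarrow> u k = z)) \<and> norm (u k - S (u (Suc k))) < \<epsilon> k"
    proof (rule dependent_nat_choice)
      show "\<exists>x. x \<in> Z \<and> (0 = (0::nat) \<longrightarrow> x = z)" using z by blast
      show "\<exists>y. (y \<in> Z \<and> (Suc n = 0 \<longrightarrow> y = z)) \<and> norm (x - S y) < \<epsilon> n"
        if "x \<in> Z \<and> (n = 0 \<longrightarrow> x = z)" for x n
        using dense[of x "\<epsilon> n"] that \<epsilon>_pos by auto
    qed
    then show ?thesis by blast
  qed
  then obtain u where u: "u 0 = z" "\<And>k. norm (u k - S (u (Suc k))) < \<epsilon> k" by blast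
  have pow_bound: "norm ((blinfun_apply S ^^ k) x) \<le> L ^ k * norm x" for k x
  proof (induction k)
    case (Suc k)
    have "norm (S ((blinfun_apply S ^^ k) x)) \<le> norm S * norm ((blinfun_apply S ^^ k) x)"
      by (rule norm_blinfun)
    also have "\<dots> \<le> L * (L ^ k * norm x)"
      using Suc \<open>L \<ge> 1\<close> by (intro mult_mono) (auto simp: L_def)
    finally show ?case by simp
  qed simp
  have step: "norm ((blinfun_apply S ^^ Suc k) (u (j + Suc k)) - (blinfun_apply S ^^ k) (u (j + k)))
      \<le> e / 4 * (1/2) ^ k" for j k
  proof -
    interpret p: bounded_linear "blinfun_apply S ^^ k"
      by (intro bounded_linear_funpow blinfun.bounded_linear_right)
    have "norm ((blinfun_apply S ^^ Suc k) (u (j + Suc k)) - (blinfun_apply S ^^ k) (u (j + k)))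
        = norm ((blinfun_apply S ^^ k) (u (j + k) - S (u (Suc (j + k)))))"
      by (simp add: p.diff funpow_swap1 norm_minus_commute del: funpow.simps add: funpow_Suc_right)
    also have "\<dots> \<le> L ^ k * \<epsilon> (j + k)"
      using pow_bound[of k] u(2)[of "j + k"] \<open>L \<ge> 1\<close>
      by (meson less_imp_le mult_left_mono order_trans zero_le_power zero_le_one)
    also have "\<dots> = (e / 4 * (1/2) ^ k) / (2 * L) ^ j"
      using \<open>L \<ge> 1\<close> by (simp add: \<epsilon>_def power_add power_mult_distrib field_simps)
    also have "\<dots> \<le> e / 4 * (1/2) ^ k / 1"
      using e \<open>L \<ge> 1\<close> by (intro divide_left_mono one_le_power) auto
    finally show ?thesis by simp
  qed
  define X where "X j k = (blinfun_apply S ^^ k) (u (j + k))" for j k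
  have "\<forall>j. \<exists>l. X j \<longlonglongrightarrow> l \<and> norm (l - u j) \<le> e / 2"
  proof
    fix j
    obtain l where "X j \<longlonglongrightarrow> l" "norm (l - X j 0) \<le> 2 * (e / 4)"
      by (rule convergent_if_increments_geometric[of "X j" "e / 4"]) (use step in \<open>simp_all add: X_def\<close>)
    then show "\<exists>l. X j \<longlonglongrightarrow> l \<and> norm (l - u j) \<le> e / 2" by (auto simp: X_def)
  qed
  then obtain v where v: "\<And>j. X j \<longlonglongrightarrow> v j" "\<And>j. norm (v j - u j) \<le> e / 2" by metis
  have "S (v (Suc j)) = v j" for j
  proof -
    have "(\<lambda>k. S (X (Suc j) k)) \<longlonglongrightarrow> S (v (Suc j))" by (intro tendsto_intros v)
    moreover have "(\<lambda>k. S (X (Suc j) k)) = (\<lambda>k. X j (Suc k))" by (simp add: X_def)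
    ultimately show ?thesis using LIMSEQ_Suc[OF v(1)[of j]] LIMSEQ_unique by metis
  qed
  then have "v 0 = (blinfun_apply S ^^ k) (v k)" for k
    by (induction k) (simp_all add: funpow_swap1)
  then show ?thesis using v(2)[of 0] u(1) e by (intro exI[of _ "v 0"]) auto
qed

section \<open>Contractions with sectorial defect\<close>

text \<open>
  The form bound and the dissipation inequality say together that \<open>|\<langle>Sx,x\<rangle>|\<close> is controlled by the
  energy that one application of \<open>T\<close> removes from \<open>x\<close>. The function \<open>q\<close> mediates between the two.
\<close>
locale dissipative_contraction =
  fixes T :: "'a::{real_inner,banach} \<Rightarrow>\<^sub>L 'a" and q :: "'a \<Rightarrow> real" and K :: real
  assumes q_nonneg: "0 \<le> q x" and K_pos: "0 < K"
    and dissipation: "q x \<le> K * ((norm x)\<^sup>2 - (norm (T x))\<^sup>2)"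
    and form_bound: "((x - T x) \<bullet> y)\<^sup>2 \<le> q x * q y"
begin

abbreviation S :: "'a \<Rightarrow>\<^sub>L 'a" where "S \<equiv> id_blinfun - T"

abbreviation Tpow :: "nat \<Rightarrow> 'a \<Rightarrow> 'a" where "Tpow n \<equiv> blinfun_apply T ^^ n"

abbreviation Spow :: "nat \<Rightarrow> 'a \<Rightarrow> 'a" where "Spow k \<equiv> blinfun_apply S ^^ k"

lemma S_apply: "S x = x - T x" by (simp add: blinfun.diff_left)

lemma T_S_commute: "T (S x) = S (T x)" by (simp add: S_apply blinfun.diff_right)

lemma bounded_linear_Tpow: "bounded_linear (Tpow n)"
  by (intro bounded_linear_funpow blinfun.bounded_linear_right)

lemma bounded_linear_Spow: "bounded_linear (Spow n)"
  by (intro bounded_linear_funpow blinfun.bounded_linear_right)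

lemma T_contraction: "norm (T x) \<le> norm x"
proof -
  have "0 \<le> K * ((norm x)\<^sup>2 - (norm (T x))\<^sup>2)" using q_nonneg dissipation order_trans by blast
  then have "(norm (T x))\<^sup>2 \<le> (norm x)\<^sup>2" using K_pos by (simp add: zero_le_mult_iff)
  then show ?thesis by (rule power2_le_imp_le) simp
qed

lemma Tpow_contraction: "norm (Tpow n x) \<le> norm x"
  by (induction n) (auto intro: order_trans[OF T_contraction])

lemma norm_S_le: "norm (S x) \<le> 2 * norm x"
  using norm_triangle_ineq4[of x "T x"] T_contraction[of x] by (simp add: S_apply)

lemma S_accretive: "0 \<le> S x \<bullet> x"
proof -
  have "T x \<bullet> x \<le> norm (T x) * norm x" by (rule norm_cauchy_schwarz)
  also have "\<dots> \<le> norm x * norm x" by (intro mult_right_mono T_contraction) simp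
  finally show ?thesis by (simp add: S_apply inner_diff_left power2_norm_eq_inner[symmetric] power2_eq_square)
qed

definition c\<^sub>1 :: real where "c\<^sub>1 = K * (1 + 2 * K + K ^ 3 / 2)"

text \<open>
  With \<open>m = n + 1\<close> and \<open>x = T\<^sup>n x\<^sub>0\<close> this says that a Lyapunov function of the orbit does not increase.
  Its last term contributes \<open>- m\<^sup>2 (\<parallel>Sx\<parallel>\<^sup>2 - \<parallel>STx\<parallel>\<^sup>2)\<close>, which is at most \<open>- m\<^sup>2 q(Sx) / K\<close>; the middle
  term produces errors of size \<open>m sqrt (q(x) q(Sx))\<close> and \<open>m q(Sx)\<close>. By the inequality of means each
  error is at most a small multiple of \<open>m\<^sup>2 q(Sx) / K\<close>, which the last term absorbs, plus a multiple of
  \<open>q(x)\<close>, which the first term pays for; the sum of the latter multiples fixes the constant \<open>c\<^sub>1\<close>.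
\<close>
lemma lyapunov_step:
  assumes m: "1 \<le> (m::real)"
  shows "c\<^sub>1 * (norm (T x))\<^sup>2 + m * (S (T x) \<bullet> T x) + m\<^sup>2 * (norm (S (T x)))\<^sup>2
    \<le> c\<^sub>1 * (norm x)\<^sup>2 + (m - 1) * (S x \<bullet> x) + (m - 1)\<^sup>2 * (norm (S x))\<^sup>2"
proof -
  define d where "d = S x"
  define D D' e Q g h where "D = (norm d)\<^sup>2" "D' = (norm (S (T x)))\<^sup>2" "e = q d" "Q = q x"
    "g = S d \<bullet> x" "h = S d \<bullet> d"
  note defs = this
  define \<delta> where "\<delta> = (norm x)\<^sup>2 - (norm (T x))\<^sup>2"
  have Tx: "T x = x - d" by (simp add: d_def S_apply)
  have ST: "S (T x) = d - S d" by (simp add: Tx blinfun.diff_right d_def)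
  have Td: "T d = S (T x)" by (simp add: d_def T_S_commute)
  have Q: "Q \<le> K * \<delta>" "0 \<le> Q" unfolding defs \<delta>_def by (rule dissipation, rule q_nonneg)
  have e: "e \<le> K * (D - D')" "0 \<le> e" unfolding defs using dissipation[of d] q_nonneg by (auto simp: Td)
  have form: "(S u \<bullet> v)\<^sup>2 \<le> q u * q v" for u v using form_bound by (simp add: S_apply)
  have a: "S x \<bullet> x \<le> Q"
    by (rule power2_le_imp_le) (use form[of x x] q_nonneg[of x] in \<open>auto simp: defs power2_eq_square\<close>)
  have h: "h \<le> e"
    by (rule power2_le_imp_le) (use form[of d d] q_nonneg[of d] in \<open>auto simp: defs power2_eq_square\<close>)
  have g2: "g\<^sup>2 \<le> e * Q" using form[of d x] by (simp add: defs)
  have D2: "D\<^sup>2 \<le> e * Q" using form[of x d] by (simp add: defs d_def power2_norm_eq_inner mult.commute)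
  have "0 \<le> D" "0 \<le> D'" by (simp_all add: defs)
  have "e \<le> K * D" using e(1) \<open>0 \<le> D'\<close> K_pos by (smt (verit) mult_left_mono)
  \<comment> \<open>Together \<open>D\<^sup>2 \<le> q(Sx) q(x)\<close> and \<open>q(Sx) \<le> K D\<close> bound \<open>q(Sx)\<close> by a multiple of \<open>q(x)\<close>.\<close>
  have "D \<le> K * Q"
  proof (cases "D = 0")
    case False
    have "D * D \<le> (K * D) * Q"
      using D2 mult_right_mono[OF \<open>e \<le> K * D\<close> Q(2)] by (simp add: power2_eq_square)
    then have "D * D \<le> D * (K * Q)" by (simp add: mult_ac)
    then show ?thesis using False \<open>0 \<le> D\<close> by (simp add: mult_le_cancel_left)
  qed (use K_pos Q in simp)
  then have e_Q: "e \<le> K * (K * Q)" using \<open>e \<le> K * D\<close> K_pos by (meson mult_left_mono less_imp_le order_trans)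
  have four_mult_le: "4 * u * v \<le> (u + v)\<^sup>2" for u v :: real
    using zero_le_power2[of "u - v"] by (simp add: power2_eq_square algebra_simps)
  have amgm: "m * t \<le> m\<^sup>2 * e / (4 * K) + K * Q" if "t\<^sup>2 \<le> e * Q" for t
  proof (rule power2_le_imp_le)
    have "(m * t)\<^sup>2 \<le> m\<^sup>2 * (e * Q)" using that by (simp add: power_mult_distrib mult_left_mono)
    also have "\<dots> = 4 * (m\<^sup>2 * e / (4 * K)) * (K * Q)" using K_pos by simp
    also have "\<dots> \<le> (m\<^sup>2 * e / (4 * K) + K * Q)\<^sup>2"
      by (rule four_mult_le)
    finally show "(m * t)\<^sup>2 \<le> (m\<^sup>2 * e / (4 * K) + K * Q)\<^sup>2" .
  qed (use K_pos Q e in simp)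
  have mD: "(m - 1) * D \<le> m\<^sup>2 * e / (4 * K) + K * Q"
    using amgm[OF D2] \<open>0 \<le> D\<close> by (simp add: left_diff_distrib)
  have mg: "- (m * g) \<le> m\<^sup>2 * e / (4 * K) + K * Q" using amgm[of "- g"] g2 by simp
  have mh: "m * h \<le> m\<^sup>2 * e / (2 * K) + K ^ 3 / 2 * Q"
  proof -
    have "m * h \<le> m * e" using h m by (intro mult_left_mono) auto
    also have "\<dots> \<le> m\<^sup>2 * e / (2 * K) + K * e / 2"
      using mult_nonneg_nonneg[OF e(2) zero_le_power2[of "m - K"]] K_pos
      by (simp add: field_simps power2_eq_square)
    also have "K * e / 2 \<le> K * (K * (K * Q)) / 2" using e_Q K_pos by simp
    finally show ?thesis by (simp add: power3_eq_cube mult.assoc)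
  qed
  have me: "m\<^sup>2 * e / K \<le> m\<^sup>2 * (D - D')"
    using e(1) K_pos mult_left_mono[of e "K * (D - D')" "m\<^sup>2"] by (simp add: field_simps)
  have a': "S (T x) \<bullet> T x = S x \<bullet> x - D - g + h"
    by (simp only: ST) (simp only: Tx, simp add: defs d_def inner_diff_left inner_diff_right power2_norm_eq_inner)
  have "m * (S (T x) \<bullet> T x) + m\<^sup>2 * D' - (m - 1) * (S x \<bullet> x) - (m - 1)\<^sup>2 * D
      = S x \<bullet> x + (m - 1) * D - m * g + m * h - m\<^sup>2 * (D - D')"
    unfolding a' by (simp add: power2_eq_square algebra_simps)
  also have "\<dots> \<le> Q + (m\<^sup>2 * e / (4 * K) + K * Q) + (m\<^sup>2 * e / (4 * K) + K * Q)
      + (m\<^sup>2 * e / (2 * K) + K ^ 3 / 2 * Q) - m\<^sup>2 * e / K"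
    using a mD mg mh me by linarith
  also have "\<dots> = (1 + 2 * K + K ^ 3 / 2) * Q" by (simp add: field_simps)
  also have "\<dots> \<le> (1 + 2 * K + K ^ 3 / 2) * (K * \<delta>)"
    using Q(1) K_pos by (intro mult_left_mono) auto
  also have "\<dots> = c\<^sub>1 * \<delta>" by (simp add: c\<^sub>1_def)
  finally show ?thesis by (simp add: \<delta>_def defs d_def algebra_simps)
qed

text \<open>
  Summing the Lyapunov inequality along the orbit bounds its last term \<open>n\<^sup>2 \<parallel>S T\<^sup>n x\<parallel>\<^sup>2\<close> by the initial
  value \<open>c\<^sub>1 \<parallel>x\<parallel>\<^sup>2\<close>. Replacing \<open>n\<close> by \<open>n + 1\<close> includes \<open>n = 0\<close> and costs the summand 2.
\<close>
lemma Tpow_S_decay: "norm (Tpow n (S x)) * real (n + 1) \<le> (sqrt c\<^sub>1 + 2) * norm x"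
proof -
  have "c\<^sub>1 * (norm (Tpow n x))\<^sup>2 + real n * (S (Tpow n x) \<bullet> Tpow n x)
      + (real n)\<^sup>2 * (norm (S (Tpow n x)))\<^sup>2 \<le> c\<^sub>1 * (norm x)\<^sup>2"
  proof (induction n)
    case (Suc n)
    show ?case using lyapunov_step[of "real (Suc n)" "Tpow n x"] Suc by simp
  qed simp
  moreover have "0 \<le> c\<^sub>1 * (norm (Tpow n x))\<^sup>2" using K_pos by (simp add: c\<^sub>1_def)
  moreover have "0 \<le> real n * (S (Tpow n x) \<bullet> Tpow n x)" using S_accretive by simp
  ultimately have "(real n * norm (S (Tpow n x)))\<^sup>2 \<le> c\<^sub>1 * (norm x)\<^sup>2" by (simp add: power_mult_distrib)
  then have "real n * norm (S (Tpow n x)) \<le> sqrt c\<^sub>1 * norm x"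
    using real_sqrt_le_mono by (fastforce simp: real_sqrt_mult)
  moreover have "norm (S (Tpow n x)) \<le> 2 * norm x"
    using norm_S_le[of "Tpow n x"] Tpow_contraction[of n x] by linarith
  moreover have "Tpow n (S x) = S (Tpow n x)"
    using funpow_commute[of T S n 1 x] T_S_commute by simp
  ultimately show ?thesis by (simp add: algebra_simps)
qed

text \<open>
  In the induction step half of the powers of \<open>T\<close> go with one factor \<open>S\<close>, the other half with the
  remaining \<open>k\<close> factors.
\<close>
lemma Tpow_Spow_decay: "\<exists>M\<ge>0. \<forall>n x. norm (Tpow n (Spow k x)) * real (n + 1) ^ k \<le> M * norm x"
proof (induction k)
  case 0 show ?case by (intro exI[of _ 1]) (simp add: Tpow_contraction)
next
  case (Suc k)
  then obtain M where M: "0 \<le> M" "\<And>n x. norm (Tpow n (Spow k x)) * real (n + 1) ^ k \<le> M * norm x" by blast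
  let ?c = "sqrt c\<^sub>1 + 2"
  have "0 \<le> ?c" using K_pos by (simp add: c\<^sub>1_def)
  have "norm (Tpow n (Spow (Suc k) x)) * real (n + 1) ^ Suc k \<le> 2 ^ Suc k * M * ?c * norm x" for n x
  proof -
    define m where "m = n div 2"
    let ?y = "Tpow m (S x)"
    have n: "n = (n - m) + m" by (simp add: m_def)
    have "Spow (Suc k) x = Spow k (S x)" by (simp add: funpow_swap1)
    then have "Tpow n (Spow (Suc k) x) = Tpow (n - m) (Spow k ?y)"
      using funpow_commute[of T S m k "S x"] T_S_commute by (subst n) (simp add: funpow_add)
    then have 1: "norm (Tpow n (Spow (Suc k) x)) * real (n - m + 1) ^ k \<le> M * norm ?y" using M(2) by simp
    have "real (n + 1) \<le> 2 * real (n - m + 1)" "real (n + 1) \<le> 2 * real (m + 1)" by (auto simp: m_def)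
    then have "real (n + 1) ^ k * real (n + 1) \<le> (2 * real (n - m + 1)) ^ k * (2 * real (m + 1))"
      by (intro mult_mono power_mono) auto
    then have "norm (Tpow n (Spow (Suc k) x)) * real (n + 1) ^ Suc k
        \<le> norm (Tpow n (Spow (Suc k) x)) * ((2 * real (n - m + 1)) ^ k * (2 * real (m + 1)))"
      by (intro mult_left_mono) (auto simp: mult.commute)
    also have "\<dots> = 2 ^ Suc k * real (m + 1) * (norm (Tpow n (Spow (Suc k) x)) * real (n - m + 1) ^ k)"
      by (simp only: power_mult_distrib power_Suc mult_ac)
    also have "\<dots> \<le> 2 ^ Suc k * real (m + 1) * (M * norm ?y)" using 1 by (intro mult_left_mono) auto
    also have "\<dots> = 2 ^ Suc k * M * (norm ?y * real (m + 1))" by (simp only: mult_ac)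
    also have "\<dots> \<le> 2 ^ Suc k * M * (?c * norm x)"
      using M(1) by (intro mult_left_mono Tpow_S_decay) auto
    finally show ?thesis by (simp only: mult_ac)
  qed
  then show ?case using M(1) \<open>0 \<le> ?c\<close> by (intro exI[of _ "2 ^ Suc k * M * ?c"]) auto
qed

lemma q_eq_0_iff: "q x = 0 \<longleftrightarrow> T x = x"
proof
  assume "q x = 0"
  then have "(S x \<bullet> S x)\<^sup>2 \<le> 0" using form_bound[of x "S x"] by (simp add: S_apply)
  then show "T x = x" by (simp add: S_apply)
next
  assume "T x = x" then show "q x = 0" using dissipation[of x] q_nonneg[of x] by simp
qed

lemma S_orthogonal_fixed: "T y = y \<Longrightarrow> S x \<bullet> y = 0"
  using form_bound[of x y] q_eq_0_iff[of y] by (simp add: S_apply)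

definition Fix :: "'a set" where "Fix = {y. T y = y}"

definition Fix_perp :: "'a set" where "Fix_perp = {z. \<forall>y\<in>Fix. z \<bullet> y = 0}"

lemma S_in_Fix_perp: "S x \<in> Fix_perp"
  using S_orthogonal_fixed by (simp add: Fix_perp_def Fix_def)

lemma subspace_Fix: "subspace Fix"
  by (auto simp: Fix_def subspace_def blinfun.add_right blinfun.scaleR_right)

lemma closed_Fix: "closed Fix"
  unfolding Fix_def by (intro closed_Collect_eq continuous_intros)

lemma Fix_decomposition: "\<exists>y\<in>Fix. x - y \<in> Fix_perp"
  using closed_subspace_projection[OF subspace_Fix closed_Fix, of x] by (simp add: Fix_perp_def)

text \<open>
  A vector \<open>r\<close> orthogonal to the range of \<open>S\<close> satisfies \<open>\<langle>Tr,r\<rangle> = \<parallel>r\<parallel>\<^sup>2\<close>, which for a contraction forces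
  \<open>Tr = r\<close>. Hence the range of \<open>S\<close> is dense in the complement of the fixed space. The approximating
  \<open>v\<close> may itself be taken from that complement, as \<open>S\<close> ignores the fixed part.
\<close>
lemma Fix_perp_approx:
  assumes z: "z \<in> Fix_perp" and e: "0 < e"
  shows "\<exists>v\<in>Fix_perp. norm (z - S v) < e"
proof -
  have sub: "subspace (range S)"
    using linear_subspace_image[of "blinfun_apply S" UNIV] by (simp add: blinfun.bounded_linear_right bounded_linear.linear)
  have "\<exists>p\<in>closure (range S). \<forall>y\<in>closure (range S). (z - p) \<bullet> y = 0"
    by (rule closed_subspace_projection[OF subspace_closure[OF sub] closed_closure])
  then obtain p where p: "p \<in> closure (range S)" "\<And>y. (z - p) \<bullet> S y = 0"
    using closure_subset[of "range S"] by blast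
  let ?r = "z - p"
  have "?r \<bullet> ?r = T ?r \<bullet> ?r" using p(2)[of ?r] by (simp add: S_apply inner_diff_right inner_commute)
  then have "(norm (?r - T ?r))\<^sup>2 = (norm (T ?r))\<^sup>2 - (norm ?r)\<^sup>2"
    by (simp add: power2_norm_eq_inner inner_diff_left inner_diff_right inner_commute)
  also have "\<dots> \<le> 0" using T_contraction[of ?r] by (simp add: power_mono)
  finally have "?r \<in> Fix" by (simp add: Fix_def)
  moreover have "?r \<in> Fix_perp"
  proof -
    have "closure (range S) \<subseteq> Fix_perp"
    proof (rule closure_minimal)
      show "range S \<subseteq> Fix_perp" using S_in_Fix_perp by blast
      have "Fix_perp = (\<Inter>y\<in>Fix. {z. z \<bullet> y = 0})" by (auto simp: Fix_perp_def)
      also have "closed \<dots>" by (intro closed_INT ballI closed_Collect_eq continuous_intros)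
      finally show "closed Fix_perp" .
    qed
    then show ?thesis using p(1) z by (auto simp: Fix_perp_def inner_diff_left)
  qed
  ultimately have "?r \<bullet> ?r = 0" unfolding Fix_perp_def by blast
  then have "z \<in> closure (range S)" using p(1) by simp
  then obtain v where v: "norm (z - S v) < e"
    using e unfolding closure_approachable by (auto simp: dist_norm norm_minus_commute)
  obtain y where y: "y \<in> Fix" "v - y \<in> Fix_perp" using Fix_decomposition by blast
  have "S (v - y) = S v" using y(1) by (simp add: Fix_def S_apply blinfun.diff_right)
  then show ?thesis using v y(2) by (intro bexI[of _ "v - y"]) auto
qed

lemma Fix_perp_dense_smooth:
  assumes "z \<in> Fix_perp" "0 < e"
  shows "\<exists>w. norm (w - z) < e \<and> (\<forall>k. \<exists>v. w = Spow k v)"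
  using mittag_leffler_dense[of Fix_perp S z e] Fix_perp_approx assms by blast

lemma Tpow_tendsto_0:
  assumes z: "z \<in> Fix_perp"
  shows "(\<lambda>n. Tpow n z) \<longlonglongrightarrow> 0"
proof (rule metric_LIMSEQ_I)
  fix e :: real assume e: "0 < e"
  obtain v where v: "norm (z - S v) < e / 2" using Fix_perp_approx[OF z, of "e / 2"] e by auto
  let ?c = "(sqrt c\<^sub>1 + 2) * norm v"
  obtain N where N: "?c / (e / 2) < real N" using reals_Archimedean2 by blast
  have "dist (Tpow n z) 0 < e" if "N \<le> n" for n
  proof -
    interpret t: bounded_linear "Tpow n" by (rule bounded_linear_Tpow)
    have "?c < e / 2 * real (n + 1)" using N that e by (simp add: field_simps) (smt (verit) mult_left_mono of_nat_mono)
    then have "norm (Tpow n (S v)) * real (n + 1) < e / 2 * real (n + 1)"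
      using Tpow_S_decay[of n v] by linarith
    then have "norm (Tpow n (S v)) < e / 2" by (simp add: mult_less_cancel_right)
    moreover have "norm (Tpow n (z - S v)) < e / 2" using v Tpow_contraction[of n "z - S v"] by simp
    ultimately have "norm (Tpow n (S v) + Tpow n (z - S v)) < e" using norm_triangle_ineq[of "Tpow n (S v)"] by (smt (verit) field_sum_of_halves)
    then show ?thesis by (simp add: t.diff)
  qed
  then show "\<exists>N. \<forall>n\<ge>N. dist (Tpow n z) 0 < e" by blast
qed

end

section \<open>Resolvents and fractional powers\<close>

text \<open>
  This is the weight that remains in Balakrishnan's integral once the integrand is estimated by the
  better of two bounds, one for \<open>l \<le> 1/N\<close> and one for larger \<open>l\<close>. Its homogeneity in \<open>N\<close> is the source
  of the fractional rate.
\<close>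
lemma has_integral_truncated_powr:
  fixes \<alpha> N :: real
  assumes \<alpha>: "0 < \<alpha>" "\<alpha> < 1" and N: "0 < N"
  shows "((\<lambda>l. if l \<le> 1 / N then 2 * l powr (\<alpha> - 1) else l powr (\<alpha> - 2) / N)
    has_integral (2 / \<alpha> + 1 / (1 - \<alpha>)) * N powr (- \<alpha>)) {0<..}"
proof -
  let ?h = "\<lambda>l. if l \<le> 1 / N then 2 * l powr (\<alpha> - 1) else l powr (\<alpha> - 2) / N"
  have "((\<lambda>l. 2 * l powr (\<alpha> - 1)) has_integral 2 * ((1 / N) powr (\<alpha> - 1 + 1) / (\<alpha> - 1 + 1))) {0..1 / N}"
    using \<alpha> N by (intro has_integral_mult_right has_integral_powr_from_0) auto
  then have 1: "(?h has_integral 2 / \<alpha> * N powr (- \<alpha>)) {0..1 / N}"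
    by (subst has_integral_cong[where g = "\<lambda>l. 2 * l powr (\<alpha> - 1)"])
       (use N in \<open>auto simp: powr_divide powr_minus divide_simps mult.commute\<close>)
  have "((\<lambda>l. l powr (\<alpha> - 2) / N) has_integral
      - ((1 / N) powr (\<alpha> - 2 + 1)) / (\<alpha> - 2 + 1) / N) {1 / N..}"
    using \<alpha> N by (intro has_integral_divide has_integral_powr_to_inf) auto
  moreover have "- ((1 / N) powr (\<alpha> - 2 + 1)) / (\<alpha> - 2 + 1) / N = 1 / (1 - \<alpha>) * N powr (- \<alpha>)"
  proof -
    have "(1 / N) powr (\<alpha> - 2 + 1) = N powr (1 - \<alpha>)"
      using N powr_minus[of N "\<alpha> - 1"] by (simp add: powr_divide inverse_eq_divide)
    also have "\<dots> = N * N powr (- \<alpha>)" using N by (simp add: powr_mult_base)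
    finally show ?thesis using \<alpha> N by (simp add: divide_simps) (simp add: algebra_simps)
  qed
  ultimately have "((\<lambda>l. l powr (\<alpha> - 2) / N) has_integral 1 / (1 - \<alpha>) * N powr (- \<alpha>)) {1 / N..}"
    by simp
  then have 2: "(?h has_integral 1 / (1 - \<alpha>) * N powr (- \<alpha>)) {1 / N..}"
    by (rule has_integral_spike_finite[where S = "{1 / N}", rotated 2]) auto
  have "{0..1 / N} \<inter> {1 / N..} = {1 / N}" using N by auto
  then have "(?h has_integral (2 / \<alpha> * N powr (- \<alpha>) + 1 / (1 - \<alpha>) * N powr (- \<alpha>))) ({0..1 / N} \<union> {1 / N..})"
    by (intro has_integral_Un 1 2) auto
  also have "{0..1 / N} \<union> {1 / N..} = {0..}" using N by (auto intro: order_trans[of 0 "1 / N"])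
  finally have "(?h has_integral (2 / \<alpha> + 1 / (1 - \<alpha>)) * N powr (- \<alpha>)) {0..}" by (simp add: distrib_right)
  then show ?thesis
  proof (rule has_integral_spike_set_eq[THEN iffD1, rotated 2])
    show "negligible {x \<in> {0..} - {0<..}. ?h x \<noteq> 0}" "negligible {x \<in> {0<..} - {0..}. ?h x \<noteq> 0}"
      by (rule negligible_subset[of "{0}"], simp, force)+
  qed
qed

context dissipative_contraction
begin

definition resolvent :: "real \<Rightarrow> 'a \<Rightarrow> 'a" where
  "resolvent l = inv (\<lambda>y. l *\<^sub>R y + S y)"

lemma shifted_S_lower:
  assumes "0 < l"
  shows "l * norm y \<le> norm (l *\<^sub>R y + S y)"
proof (cases "y = 0")
  case False
  have "(l * norm y) * norm y \<le> (l *\<^sub>R y + S y) \<bullet> y"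
    using S_accretive[of y] by (simp add: inner_add_left power2_norm_eq_inner[symmetric] power2_eq_square)
  also have "\<dots> \<le> norm (l *\<^sub>R y + S y) * norm y" by (rule norm_cauchy_schwarz)
  finally show ?thesis using False by (simp add: mult_le_cancel_right)
qed simp

text \<open>
  Accretivity of \<open>S\<close> gives injectivity. Since \<open>l + S = (l + 1) - T\<close> and \<open>T\<close> is a contraction, the
  equation \<open>l y + S y = w\<close> is a fixed point problem with contraction factor \<open>1 / (l + 1)\<close>.
\<close>
lemma bij_shifted_S:
  assumes l: "0 < l"
  shows "bij (\<lambda>y. l *\<^sub>R y + S y)"
  unfolding bij_def
proof
  show "inj (\<lambda>y. l *\<^sub>R y + S y)"
  proof (rule injI)
    fix x y assume "l *\<^sub>R x + S x = l *\<^sub>R y + S y"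
    then have "l *\<^sub>R (x - y) + S (x - y) = 0"
      by (simp only: blinfun.diff_right scaleR_diff_right) (simp add: algebra_simps)
    then have "l * norm (x - y) \<le> 0" using shifted_S_lower[OF l, of "x - y"] by simp
    then show "x = y" using l by (simp add: mult_le_0_iff)
  qed
  have "\<exists>y. w = l *\<^sub>R y + S y" for w
  proof -
    define f where "f y = (1 / (l + 1)) *\<^sub>R (w + T y)" for y
    have "dist (f x) (f y) \<le> 1 / (l + 1) * dist x y" for x y
    proof -
      have "f x - f y = (1 / (l + 1)) *\<^sub>R T (x - y)"
        by (simp add: f_def blinfun.diff_right scaleR_diff_right[symmetric])
      then show ?thesis using T_contraction[of "x - y"] l by (simp add: dist_norm divide_right_mono)
    qed
    then obtain y where "f y = y" using banach_fix_type[of "1 / (l + 1)" f] l by auto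
    then have "(l + 1) *\<^sub>R y = (l + 1) *\<^sub>R f y" by simp
    also have "\<dots> = w + T y" using l by (simp add: f_def)
    finally have "(l + 1) *\<^sub>R y = w + T y" .
    then show ?thesis by (intro exI[of _ y]) (simp add: S_apply algebra_simps)
  qed
  then show "surj (\<lambda>y. l *\<^sub>R y + S y)" unfolding surj_def by blast
qed

lemma resolvent_solves: "0 < l \<Longrightarrow> l *\<^sub>R resolvent l w + S (resolvent l w) = w"
  unfolding resolvent_def using surj_f_inv_f[OF bij_is_surj[OF bij_shifted_S]] by fast

lemma resolvent_unique: "0 < l \<Longrightarrow> l *\<^sub>R y + S y = w \<Longrightarrow> resolvent l w = y"
  using resolvent_solves[of l w] bij_is_inj[OF bij_shifted_S, of l] unfolding inj_def by blast

lemma resolvent_add: "0 < l \<Longrightarrow> resolvent l (v + w) = resolvent l v + resolvent l w"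
proof (rule resolvent_unique)
  assume l: "0 < l"
  have "l *\<^sub>R (resolvent l v + resolvent l w) + S (resolvent l v + resolvent l w)
      = (l *\<^sub>R resolvent l v + S (resolvent l v)) + (l *\<^sub>R resolvent l w + S (resolvent l w))"
    by (simp add: blinfun.add_right algebra_simps)
  then show "l *\<^sub>R (resolvent l v + resolvent l w) + S (resolvent l v + resolvent l w) = v + w"
    by (simp only: resolvent_solves[OF l])
qed

lemma resolvent_S: "0 < l \<Longrightarrow> resolvent l (S w) = S (resolvent l w)"
  using resolvent_solves[of l w]
  by (intro resolvent_unique) (simp_all only: blinfun.add_right[symmetric] blinfun.scaleR_right[symmetric])

lemma norm_resolvent: "0 < l \<Longrightarrow> norm (resolvent l w) \<le> norm w / l"
  using shifted_S_lower[of l "resolvent l w"] by (simp add: resolvent_solves field_simps)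

lemma norm_S_resolvent:
  assumes l: "0 < l"
  shows "norm (S (resolvent l w)) \<le> 2 * norm w"
proof -
  have "S (resolvent l w) = w - l *\<^sub>R resolvent l w"
    using resolvent_solves[OF l, of w] by (simp only: eq_diff_eq add.commute)
  then have "norm (S (resolvent l w)) \<le> norm w + l * norm (resolvent l w)"
    using norm_triangle_ineq4[of w "l *\<^sub>R resolvent l w"] l by simp
  also have "l * norm (resolvent l w) \<le> norm w" using norm_resolvent[OF l, of w] l by (simp add: field_simps)
  finally show ?thesis by simp
qed

text \<open>
  For small \<open>l\<close> one factor \<open>S\<close> is spent on the resolvent, as \<open>\<parallel>S (l + S)\<^sup>-\<^sup>1\<parallel> \<le> 2\<close>; for large \<open>l\<close> all
  factors go with the powers of \<open>T\<close> and the resolvent contributes \<open>1 / l\<close>.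
\<close>
lemma Tpow_resolvent_decay:
  "\<exists>M\<ge>0. \<forall>n l x. 0 < l \<longrightarrow>
     norm (Tpow n (Spow (Suc k) (resolvent l x))) * real (n + 1) ^ k
       \<le> M * (if l \<le> 1 / real (n + 1) then 2 else 1 / (l * real (n + 1))) * norm x"
proof -
  obtain M where M: "0 \<le> M" "\<And>n x. norm (Tpow n (Spow k x)) * real (n + 1) ^ k \<le> M * norm x"
    using Tpow_Spow_decay[of k] by blast
  obtain M' where M': "0 \<le> M'" "\<And>n x. norm (Tpow n (Spow (Suc k) x)) * real (n + 1) ^ Suc k \<le> M' * norm x"
    using Tpow_Spow_decay[of "Suc k"] by blast
  have "norm (Tpow n (Spow (Suc k) (resolvent l x))) * real (n + 1) ^ k
      \<le> (M + M') * (if l \<le> 1 / real (n + 1) then 2 else 1 / (l * real (n + 1))) * norm x"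
    if l: "0 < l" for n l x
  proof (cases "l \<le> 1 / real (n + 1)")
    case True
    have "norm (Tpow n (Spow k (S (resolvent l x)))) * real (n + 1) ^ k \<le> M * norm (S (resolvent l x))"
      by (rule M)
    also have "\<dots> \<le> M * (2 * norm x)" using M(1) by (intro mult_left_mono norm_S_resolvent l)
    also have "\<dots> \<le> (M + M') * 2 * norm x" using M'(1) by (simp add: algebra_simps)
    finally show ?thesis using True by (simp add: funpow_swap1)
  next
    case False
    let ?N = "real (n + 1)"
    have N: "0 < ?N" by simp
    have "norm (Tpow n (Spow (Suc k) (resolvent l x))) * ?N ^ Suc k \<le> M' * norm (resolvent l x)"
      by (rule M')
    also have "\<dots> \<le> (M + M') * (norm x / l)"
      using M(1) M'(1) l by (intro mult_mono norm_resolvent) auto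
    finally have "norm (Tpow n (Spow (Suc k) (resolvent l x))) * ?N ^ k \<le> (M + M') * (norm x / l) / ?N"
      unfolding pos_le_divide_eq[OF N] by (simp only: power_Suc mult_ac)
    then show ?thesis using False by (simp add: mult_ac)
  qed
  then show ?thesis using M(1) M'(1) by (intro exI[of _ "M + M'"]) auto
qed

definition balakrishnan :: "real \<Rightarrow> 'a \<Rightarrow> 'a" where
  "balakrishnan \<alpha> u = integral {0<..} (\<lambda>l. l powr (\<alpha> - 1) *\<^sub>R inv (\<lambda>y. l *\<^sub>R y + S y) (S u))"

text \<open>
  The two resolvent bounds are integrated against \<open>l\<^sup>\<alpha>\<^sup>-\<^sup>1\<close>. The decomposition of the argument is what later
  turns the rate \<open>O\<close> into \<open>o\<close>: the fixed part \<open>y\<close> is annihilated, the part \<open>S v\<close> gains a further factor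
  \<open>1 / (n + 1)\<close>, and the remainder \<open>r\<close> can be made small by density. The decomposition
  is made under the integral sign, so that only the integrand has to be linear in its argument.
\<close>
lemma Tpow_balakrishnan_bound:
  assumes \<alpha>: "0 < \<alpha>" "\<alpha> < 1"
  shows "\<exists>A\<ge>0. \<forall>n y v r. y \<in> Fix \<longrightarrow>
    norm (Tpow n (Spow k (balakrishnan \<alpha> (y + S v + r))))
      \<le> A * real (n + 1) powr (- (real k + \<alpha>)) * (norm v / real (n + 1) + norm r)"
proof -
  let ?m = "\<lambda>l N. if l \<le> 1 / N then 2 else 1 / (l * N) :: real"
  obtain M where M: "0 \<le> M" "\<And>n l x. 0 < l \<Longrightarrow>
      norm (Tpow n (Spow (Suc k) (resolvent l x))) * real (n + 1) ^ k \<le> M * ?m l (real (n + 1)) * norm x"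
    using Tpow_resolvent_decay[of k] by blast
  obtain M' where M': "0 \<le> M'" "\<And>n l x. 0 < l \<Longrightarrow>
      norm (Tpow n (Spow (Suc (Suc k)) (resolvent l x))) * real (n + 1) ^ Suc k \<le> M' * ?m l (real (n + 1)) * norm x"
    using Tpow_resolvent_decay[of "Suc k"] by blast
  let ?A = "(M + M') * (2 / \<alpha> + 1 / (1 - \<alpha>))"
  have "norm (Tpow n (Spow k (balakrishnan \<alpha> (y + S v + r))))
      \<le> ?A * real (n + 1) powr (- (real k + \<alpha>)) * (norm v / real (n + 1) + norm r)"
    if y: "y \<in> Fix" for n y v r
  proof -
    define N where "N = real (n + 1)"
    have N: "0 < N" by (simp add: N_def)
    define u where "u = y + S v + r"
    define f where "f l = l powr (\<alpha> - 1) *\<^sub>R resolvent l (S u)" for l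
    define \<rho> where "\<rho> = norm v / N + norm r"
    have "0 \<le> \<rho>" using N by (simp add: \<rho>_def)
    define L where "L x = Tpow n (Spow k x)" for x
    have L: "bounded_linear L"
      unfolding L_def using bounded_linear_compose[OF bounded_linear_Tpow bounded_linear_Spow] .
    interpret L: bounded_linear L by (rule L)
    have J: "balakrishnan \<alpha> u = integral {0<..} f"
      by (simp only: balakrishnan_def f_def[abs_def] resolvent_def)
    define h where "h l = (if l \<le> 1 / N then 2 * l powr (\<alpha> - 1) else l powr (\<alpha> - 2) / N)" for l
    have h: "(h has_integral (2 / \<alpha> + 1 / (1 - \<alpha>)) * N powr (- \<alpha>)) {0<..}"
      unfolding h_def using has_integral_truncated_powr[OF \<alpha> N] .
    have bound: "norm (L (f l)) \<le> h l * ((M + M') * \<rho> / N ^ k)" if l: "l \<in> {0<..}" for l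
    proof -
      have l': "0 < l" using l by simp
      have "S u = S (S v + r)" using y by (simp add: u_def Fix_def S_apply blinfun.add_right)
      then have "resolvent l (S u) = S (S (resolvent l v)) + S (resolvent l r)"
        using l' by (simp add: resolvent_S resolvent_add blinfun.add_right)
      then have "L (resolvent l (S u)) = L (S (S (resolvent l v))) + L (S (resolvent l r))"
        by (simp add: L.add)
      also have "\<dots> = Tpow n (Spow (Suc (Suc k)) (resolvent l v)) + Tpow n (Spow (Suc k) (resolvent l r))"
        by (simp add: L_def funpow_swap1)
      finally have "norm (L (resolvent l (S u))) \<le>
          norm (Tpow n (Spow (Suc (Suc k)) (resolvent l v))) + norm (Tpow n (Spow (Suc k) (resolvent l r)))"
        by (simp only: norm_triangle_ineq)
      also have "\<dots> \<le> M' * ?m l N * norm v / N ^ Suc k + M * ?m l N * norm r / N ^ k"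
        using M(2)[OF l', of n r] M'(2)[OF l', of n v] N unfolding N_def[symmetric]
        by (intro add_mono) (simp_all only: pos_le_divide_eq zero_less_power)
      also have "\<dots> = ?m l N * (M' * (norm v / N) + M * norm r) / N ^ k"
        using N by (simp only: power_Suc) (simp add: field_simps)
      also have "\<dots> \<le> ?m l N * ((M + M') * \<rho>) / N ^ k"
      proof (intro divide_right_mono mult_left_mono)
        have "M' * (norm v / N) + M * norm r \<le> (M + M') * (norm v / N) + (M + M') * norm r"
          using M(1) M'(1) N by (intro add_mono mult_right_mono) auto
        then show "M' * (norm v / N) + M * norm r \<le> (M + M') * \<rho>" by (simp add: \<rho>_def distrib_left)
      qed (use N l' in auto)
      finally have "l powr (\<alpha> - 1) * norm (L (resolvent l (S u)))
          \<le> l powr (\<alpha> - 1) * (?m l N * ((M + M') * \<rho>) / N ^ k)" by (intro mult_left_mono) auto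
      also have "l powr (\<alpha> - 1) * (?m l N * ((M + M') * \<rho>) / N ^ k)
          = (l powr (\<alpha> - 1) * ?m l N) * ((M + M') * \<rho> / N ^ k)" by simp
      also have "l powr (\<alpha> - 1) * ?m l N = h l"
        using l' powr_diff[of l "\<alpha> - 1" 1] by (simp add: h_def)
      finally show ?thesis by (simp add: f_def L.scaleR)
    qed
    have "norm (L (integral {0<..} f)) \<le> ((2 / \<alpha> + 1 / (1 - \<alpha>)) * N powr (- \<alpha>)) * ((M + M') * \<rho> / N ^ k)"
    proof (cases "f integrable_on {0<..}")
      case True
      then have "norm (integral {0<..} (L \<circ> f)) \<le> integral {0<..} (\<lambda>l. h l * ((M + M') * \<rho> / N ^ k))"
      proof (intro integral_norm_bound_integral integrable_linear[OF _ L] integrable_on_mult_left)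
        show "h integrable_on {0<..}" using h by (auto simp: integrable_on_def)
        show "norm ((L \<circ> f) l) \<le> h l * ((M + M') * \<rho> / N ^ k)" if "l \<in> {0<..}" for l
          using bound[OF that] by (simp only: comp_apply)
      qed
      also have "\<dots> = ((2 / \<alpha> + 1 / (1 - \<alpha>)) * N powr (- \<alpha>)) * ((M + M') * \<rho> / N ^ k)"
        by (intro integral_unique has_integral_mult_left h)
      finally show ?thesis using integral_linear[OF True L] by simp
    next
      \<comment> \<open>The integral of a function that is not integrable has the default value 0.\<close>
      case False
      then show ?thesis
        using M(1) M'(1) N \<open>0 \<le> \<rho>\<close> \<alpha> by (simp add: not_integrable_integral L.zero)
    qed
    also have "\<dots> = ?A * (N powr (- \<alpha>) / N ^ k) * \<rho>" by simp
    also have "N powr (- \<alpha>) / N ^ k = N powr (- (real k + \<alpha>))"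
      using N powr_diff[of N "- \<alpha>" "real k"] by (simp add: powr_realpow add.commute)
    finally show ?thesis by (simp only: J[symmetric] L_def N_def u_def \<rho>_def)
  qed
  moreover have "0 \<le> ?A" using M(1) M'(1) \<alpha> by simp
  ultimately show ?thesis by blast
qed

text \<open>
  The constant \<open>c\<close> stands for the normalization \<open>sin (\<pi> \<alpha>) / \<pi>\<close>. For \<open>u = y + S v + r\<close> with small \<open>r\<close>, the
  product \<open>\<parallel>T\<^sup>n w\<parallel> (n + 1)\<^sup>\<gamma>\<close> is at most a multiple of \<open>\<parallel>v\<parallel> / (n + 1) + \<parallel>r\<parallel>\<close>.
\<close>
lemma Tpow_frac_power_decay:
  assumes \<gamma>: "0 < \<gamma>"
    and w: "w = Spow (nat \<lfloor>\<gamma>\<rfloor>) (if frac \<gamma> = 0 then u else c *\<^sub>R balakrishnan (frac \<gamma>) u)"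
  shows "(\<lambda>n. norm (Tpow n w) * real (n + 1) powr \<gamma>) \<longlonglongrightarrow> 0"
proof -
  define k \<alpha> where "k = nat \<lfloor>\<gamma>\<rfloor>" "\<alpha> = frac \<gamma>"
  have \<gamma>_eq: "real k + \<alpha> = \<gamma>" using \<gamma> by (simp add: k_\<alpha>_def frac_def)
  have "\<exists>A\<ge>0. \<forall>n y v r. y \<in> Fix \<longrightarrow> u = y + S v + r \<longrightarrow>
    norm (Tpow n w) \<le> A * real (n + 1) powr (- \<gamma>) * (norm v / real (n + 1) + norm r)"
  proof (cases "\<alpha> = 0")
    case True
    have "k \<noteq> 0" using True \<gamma>_eq \<gamma> by simp
    have w': "w = Spow k u" using w True by (simp add: k_\<alpha>_def)
    obtain M where M: "0 \<le> M" "\<And>n x. norm (Tpow n (Spow k x)) * real (n + 1) ^ k \<le> M * norm x"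
      using Tpow_Spow_decay[of k] by blast
    obtain M' where M': "0 \<le> M'" "\<And>n x. norm (Tpow n (Spow (Suc k) x)) * real (n + 1) ^ Suc k \<le> M' * norm x"
      using Tpow_Spow_decay[of "Suc k"] by blast
    have "norm (Tpow n w) \<le> (M + M') * real (n + 1) powr (- \<gamma>) * (norm v / real (n + 1) + norm r)"
      if y: "y \<in> Fix" and u: "u = y + S v + r" for n y v r
    proof -
      define N where "N = real (n + 1)"
      have N: "0 < N" by (simp add: N_def)
      interpret t: bounded_linear "Tpow n" by (rule bounded_linear_Tpow)
      interpret s: bounded_linear "Spow k" by (rule bounded_linear_Spow)
      have "Spow k y = 0"
      proof -
        obtain j where "k = Suc j" using \<open>k \<noteq> 0\<close> by (cases k) auto
        moreover have "Spow j 0 = 0" by (induction j) simp_all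
        ultimately show ?thesis using y by (simp add: Fix_def S_apply funpow_swap1)
      qed
      then have "Tpow n w = Tpow n (Spow (Suc k) v) + Tpow n (Spow k r)"
        by (simp add: w' u s.add t.add funpow_swap1)
      then have "norm (Tpow n w) \<le> norm (Tpow n (Spow (Suc k) v)) + norm (Tpow n (Spow k r))"
        by (simp only: norm_triangle_ineq)
      also have "\<dots> \<le> M' * norm v / N ^ Suc k + M * norm r / N ^ k"
        using M(2)[of n r] M'(2)[of n v] N unfolding N_def[symmetric]
        by (intro add_mono) (simp_all only: pos_le_divide_eq zero_less_power)
      also have "\<dots> \<le> (M + M') * norm v / N ^ Suc k + (M + M') * norm r / N ^ k"
        using M(1) M'(1) N by (intro add_mono divide_right_mono mult_right_mono) auto
      also have "\<dots> = (M + M') * (1 / N ^ k) * (norm v / N + norm r)"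
        using N by (simp only: power_Suc) (simp add: field_simps)
      also have "1 / N ^ k = N powr (- \<gamma>)"
        using N \<gamma>_eq True by (simp add: powr_minus_divide powr_realpow[symmetric])
      finally show ?thesis by (simp only: N_def)
    qed
    then show ?thesis using M(1) M'(1) by (intro exI[of _ "M + M'"]) simp
  next
    case False
    have \<alpha>: "0 < \<alpha>" "\<alpha> < 1" using False frac_lt_1[of \<gamma>] frac_ge_0[of \<gamma>] by (simp_all add: k_\<alpha>_def)
    obtain A where A: "0 \<le> A" "\<And>n y v r. y \<in> Fix \<Longrightarrow> norm (Tpow n (Spow k (balakrishnan \<alpha> (y + S v + r))))
        \<le> A * real (n + 1) powr (- \<gamma>) * (norm v / real (n + 1) + norm r)"
      using Tpow_balakrishnan_bound[OF \<alpha>, of k] unfolding \<gamma>_eq by blast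
    have "norm (Tpow n w) \<le> (\<bar>c\<bar> * A) * real (n + 1) powr (- \<gamma>) * (norm v / real (n + 1) + norm r)"
      if "y \<in> Fix" "u = y + S v + r" for n y v r
    proof -
      interpret t: bounded_linear "Tpow n" by (rule bounded_linear_Tpow)
      interpret s: bounded_linear "Spow k" by (rule bounded_linear_Spow)
      have "w = Spow k (c *\<^sub>R balakrishnan \<alpha> u)" using w False by (simp add: k_\<alpha>_def)
      then have "norm (Tpow n w) = \<bar>c\<bar> * norm (Tpow n (Spow k (balakrishnan \<alpha> u)))"
        by (simp add: t.scaleR s.scaleR)
      also have "\<dots> \<le> \<bar>c\<bar> * (A * real (n + 1) powr (- \<gamma>) * (norm v / real (n + 1) + norm r))"
        unfolding that(2) by (intro mult_left_mono A(2) that(1)) simp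
      finally show ?thesis by (simp only: mult.assoc)
    qed
    then show ?thesis using A(1) by (intro exI[of _ "\<bar>c\<bar> * A"]) simp
  qed
  then obtain A where A: "0 \<le> A" "\<And>n y v r. y \<in> Fix \<Longrightarrow> u = y + S v + r \<Longrightarrow>
    norm (Tpow n w) \<le> A * real (n + 1) powr (- \<gamma>) * (norm v / real (n + 1) + norm r)" by blast
  obtain y where y: "y \<in> Fix" "u - y \<in> Fix_perp" using Fix_decomposition by blast
  show ?thesis
  proof (rule metric_LIMSEQ_I)
    fix e :: real assume e: "0 < e"
    define a where "a = A + 1"
    have a: "0 < a" "A < a" using A(1) by (simp_all add: a_def)
    define \<delta> where "\<delta> = e / 2 / a"
    have \<delta>: "0 < \<delta>" using e a by (simp add: \<delta>_def)
    obtain v where v: "norm (u - y - S v) < \<delta>" using Fix_perp_approx[OF y(2) \<delta>] by blast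
    obtain m where m: "norm v / \<delta> < real m" using reals_Archimedean2 by blast
    have "dist (norm (Tpow n w) * real (n + 1) powr \<gamma>) 0 < e" if "m \<le> n" for n
    proof -
      have "real m \<le> real (n + 1)" using that by simp
      then have "norm v / \<delta> < real (n + 1)" using m by linarith
      then have "norm v / real (n + 1) < \<delta>" using \<delta> by (simp add: divide_less_eq mult.commute)
      have "norm (Tpow n w) * real (n + 1) powr \<gamma>
          \<le> A * real (n + 1) powr (- \<gamma>) * (norm v / real (n + 1) + norm (u - y - S v)) * real (n + 1) powr \<gamma>"
        by (intro mult_right_mono A(2)[OF y(1)]) auto
      also have "\<dots> = A * (norm v / real (n + 1) + norm (u - y - S v)) *
          (real (n + 1) powr (- \<gamma>) * real (n + 1) powr \<gamma>)" by (simp only: mult_ac)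
      also have "real (n + 1) powr (- \<gamma>) * real (n + 1) powr \<gamma> = 1" by (simp flip: powr_add)
      also have "A * (norm v / real (n + 1) + norm (u - y - S v)) * 1 \<le> A * (2 * \<delta>)"
        using v \<open>norm v / real (n + 1) < \<delta>\<close> A(1) by (simp only: mult_1_right) (intro mult_left_mono, auto)
      also have "\<dots> < a * (2 * \<delta>)" using \<delta> a by simp
      also have "\<dots> = e" using a by (simp add: \<delta>_def)
      finally show ?thesis by simp
    qed
    then show "\<exists>m. \<forall>n\<ge>m. dist (norm (Tpow n w) * real (n + 1) powr \<gamma>) 0 < e" by blast
  qed
qed

text \<open>
  Writing \<open>w = S\<^sup>k v\<close> with \<open>k \<ge> \<gamma> + 1\<close> leaves a factor \<open>1 / (n + 1)\<close> to spare.
\<close>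
lemma Tpow_smooth_decay:
  assumes w: "\<And>k. \<exists>v. w = Spow k v"
  shows "(\<lambda>n. norm (Tpow n w) * real (n + 1) powr \<gamma>) \<longlonglongrightarrow> 0"
proof -
  define k where "k = nat \<lceil>\<gamma>\<rceil> + 1"
  have k: "\<gamma> + 1 \<le> real k" unfolding k_def by linarith
  obtain v where v: "w = Spow k v" using w by blast
  obtain M where M: "0 \<le> M" "\<And>n x. norm (Tpow n (Spow k x)) * real (n + 1) ^ k \<le> M * norm x"
    using Tpow_Spow_decay[of k] by blast
  show ?thesis
  proof (rule Lim_null_comparison)
    show "\<forall>\<^sub>F n in sequentially. norm (norm (Tpow n w) * real (n + 1) powr \<gamma>) \<le> M * norm v * inverse (real (Suc n))"
    proof (rule always_eventually, rule allI)
      fix n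
      let ?N = "real (n + 1)"
      have "norm (Tpow n w) * ?N powr \<gamma> * ?N = norm (Tpow n w) * ?N powr (\<gamma> + 1)"
        by (simp add: powr_add)
      also have "\<dots> \<le> norm (Tpow n w) * ?N powr (real k)"
        using k by (intro mult_left_mono powr_mono) auto
      also have "\<dots> = norm (Tpow n w) * ?N ^ k" by (subst powr_realpow) auto
      also have "\<dots> \<le> M * norm v" unfolding v by (rule M)
      finally show "norm (norm (Tpow n w) * ?N powr \<gamma>) \<le> M * norm v * inverse (real (Suc n))"
        by (simp add: field_simps)
    qed
    show "(\<lambda>n. M * norm v * inverse (real (Suc n))) \<longlonglongrightarrow> 0"
      by (rule tendsto_mult_right_zero[OF LIMSEQ_inverse_real_of_nat])
  qed
qed

lemma T_in_Fix_perp: "w \<in> Fix_perp \<Longrightarrow> T w \<in> Fix_perp"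
  using S_in_Fix_perp[of w] by (simp add: Fix_perp_def S_apply inner_diff_left)

text \<open>
  If \<open>T\<^sup>n\<close> halves the norm of \<open>w\<close>, then \<open>w - T\<^sup>n w\<close>, a sum of \<open>n\<close> vectors \<open>T\<^sup>j S w\<close>, has norm at least
  \<open>\<parallel>w\<parallel> / 2\<close>, so \<open>S w\<close> is not small. On the other hand \<open>\<parallel>S w\<parallel>\<^sup>2 \<le> K q(w)\<close>, by the form bound with
  \<open>y = S w\<close>.
\<close>
lemma coercive_if_power_contracts:
  assumes half: "\<And>w. w \<in> Fix_perp \<Longrightarrow> norm (Tpow n w) \<le> norm w / 2"
  shows "\<exists>\<kappa>>0. \<forall>w\<in>Fix_perp. \<kappa>\<^sup>2 * (norm w)\<^sup>2 \<le> q w"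
proof -
  define c where "c = 2 * real (n + 1)"
  have "0 < c" by (simp add: c_def)
  define \<kappa> where "\<kappa> = 1 / (c * sqrt K)"
  have "\<kappa> > 0" using K_pos \<open>0 < c\<close> by (simp add: \<kappa>_def)
  moreover have "\<kappa>\<^sup>2 * (norm w)\<^sup>2 \<le> q w" if w: "w \<in> Fix_perp" for w
  proof -
    have "norm (w - Tpow j w) \<le> real j * norm (S w)" for j
    proof (induction j)
      case (Suc j)
      have "w - Tpow (Suc j) w = (w - Tpow j w) + Tpow j (S w)"
      proof -
        interpret t: bounded_linear "Tpow j" by (rule bounded_linear_Tpow)
        show ?thesis by (simp add: S_apply t.diff funpow_swap1)
      qed
      then have "norm (w - Tpow (Suc j) w) \<le> norm (w - Tpow j w) + norm (Tpow j (S w))"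
        by (simp only: norm_triangle_ineq)
      then show ?case using Suc Tpow_contraction[of j "S w"] by (simp add: algebra_simps)
    qed simp
    from this[of n] have "norm w \<le> 2 * (real n * norm (S w))"
      using half[OF w] norm_triangle_ineq2[of w "Tpow n w"] by linarith
    also have "\<dots> \<le> c * norm (S w)" by (simp add: c_def distrib_right)
    finally have "norm w \<le> c * norm (S w)" .
    moreover have "(norm (S w))\<^sup>2 \<le> K * q w"
    proof (cases "S w = 0")
      case False
      have "(norm (S w))\<^sup>2 * (norm (S w))\<^sup>2 = (S w \<bullet> S w)\<^sup>2"
        by (simp only: power2_norm_eq_inner power2_eq_square[of "S w \<bullet> S w"])
      also have "\<dots> \<le> q w * q (S w)" using form_bound[of w "S w"] by (simp only: S_apply)
      also have "\<dots> \<le> q w * (K * (norm (S w))\<^sup>2)"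
      proof (intro mult_left_mono q_nonneg)
        have "q (S w) \<le> K * ((norm (S w))\<^sup>2 - (norm (T (S w)))\<^sup>2)" by (rule dissipation)
        also have "\<dots> \<le> K * (norm (S w))\<^sup>2" using K_pos by (intro mult_left_mono) auto
        finally show "q (S w) \<le> K * (norm (S w))\<^sup>2" .
      qed
      finally have "(norm (S w))\<^sup>2 * (norm (S w))\<^sup>2 \<le> (K * q w) * (norm (S w))\<^sup>2" by (simp only: mult_ac)
      then show ?thesis by (rule mult_right_le_imp_le) (use False in simp)
    qed (use K_pos q_nonneg in simp)
    ultimately have "(norm w)\<^sup>2 \<le> c\<^sup>2 * (K * q w)"
      using power_mono[of "norm w" "c * norm (S w)" 2] mult_left_mono[of "(norm (S w))\<^sup>2" "K * q w" "c\<^sup>2"]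
      by (simp add: power_mult_distrib c_def[symmetric])
    then show ?thesis using K_pos \<open>0 < c\<close> by (simp add: \<kappa>_def power_divide power_mult_distrib field_simps)
  qed
  ultimately show ?thesis by blast
qed

lemma Tpow_geometric_if_coercive:
  assumes \<kappa>: "0 < \<kappa>" and coercive: "\<And>w. w \<in> Fix_perp \<Longrightarrow> \<kappa>\<^sup>2 * (norm w)\<^sup>2 \<le> q w"
  shows "\<exists>\<rho>. 0 < \<rho> \<and> \<rho> < 1 \<and> (\<forall>n. \<forall>w\<in>Fix_perp. norm (Tpow n w) \<le> \<rho> ^ n * norm w)"
proof -
  \<comment> \<open>The minimum keeps the contraction factor \<open>sqrt (1 - c)\<close> away from zero.\<close>
  define c where "c = min (\<kappa>\<^sup>2 / K) (1/2)"
  have c: "0 < c" "c < 1" "c \<le> \<kappa>\<^sup>2 / K" using \<kappa> K_pos by (auto simp: c_def)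
  define \<rho> where "\<rho> = sqrt (1 - c)"
  have \<rho>: "0 < \<rho>" "\<rho> < 1" using c by (auto simp: \<rho>_def)
  have T: "norm (T w) \<le> \<rho> * norm w" if "w \<in> Fix_perp" for w
  proof -
    have "c * (norm w)\<^sup>2 \<le> \<kappa>\<^sup>2 / K * (norm w)\<^sup>2" using c(3) by (rule mult_right_mono) simp
    also have "\<dots> \<le> (norm w)\<^sup>2 - (norm (T w))\<^sup>2"
      using order_trans[OF coercive[OF that] dissipation[of w]] K_pos by (simp add: field_simps)
    finally have "(norm (T w))\<^sup>2 \<le> (1 - c) * (norm w)\<^sup>2" by (simp add: algebra_simps)
    also have "\<dots> = (\<rho> * norm w)\<^sup>2" using c by (simp add: \<rho>_def power_mult_distrib)
    finally show ?thesis by (rule power2_le_imp_le) (use \<rho> in simp)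
  qed
  have "norm (Tpow n w) \<le> \<rho> ^ n * norm w \<and> Tpow n w \<in> Fix_perp" if "w \<in> Fix_perp" for n w
  proof (induction n)
    case (Suc n)
    have "norm (T (Tpow n w)) \<le> \<rho> * norm (Tpow n w)" using Suc T by blast
    also have "\<dots> \<le> \<rho> * (\<rho> ^ n * norm w)" using Suc \<rho> by (intro mult_left_mono) auto
    finally show ?case using Suc T_in_Fix_perp by simp
  qed (use that in simp)
  then show ?thesis using \<rho> by blast
qed

end

section \<open>From the monodromy operator to continuous time\<close>

lemma tendsto_0_if_sampled:
  fixes f :: "real \<Rightarrow> real" and a :: "nat \<Rightarrow> real"
  assumes "0 < \<tau>" and le: "\<And>t. 0 \<le> t \<Longrightarrow> \<bar>f t\<bar> \<le> a (nat \<lfloor>t / \<tau>\<rfloor>)" and a: "a \<longlonglongrightarrow> 0"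
  shows "(f \<longlongrightarrow> 0) at_top"
proof (rule Lim_null_comparison)
  show "\<forall>\<^sub>F t in at_top. norm (f t) \<le> a (nat \<lfloor>t / \<tau>\<rfloor>)"
    using eventually_ge_at_top[of 0] by eventually_elim (use le in simp)
  have "filterlim (\<lambda>t::real. t / \<tau>) at_top at_top"
    using \<open>0 < \<tau>\<close> by (intro filterlim_tendsto_pos_mult_at_top[OF tendsto_const, of "1 / \<tau>", simplified] filterlim_ident) auto
  then have "filterlim (\<lambda>t. nat \<lfloor>t / \<tau>\<rfloor>) at_top at_top"
    by (intro filterlim_compose[OF filterlim_nat_sequentially] filterlim_compose[OF filterlim_floor_sequentially])
  then show "((\<lambda>t. a (nat \<lfloor>t / \<tau>\<rfloor>)) \<longlongrightarrow> 0) at_top" by (rule filterlim_compose[OF a])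
qed

lemma less_Suc_nat_floor: "0 \<le> x \<Longrightarrow> x < real (nat \<lfloor>x\<rfloor> + 1)"
  by linarith

text \<open>
  Sampling at multiples of \<open>\<tau>\<close> costs only the factor \<open>\<tau>\<^sup>\<gamma>\<close>, because \<open>t < \<tau> (n + 1)\<close> for the number
  \<open>n\<close> of periods completed at time \<open>t\<close>.
\<close>
lemma smallo_powr_if_sampled:
  fixes f :: "real \<Rightarrow> real" and a :: "nat \<Rightarrow> real"
  assumes \<tau>: "0 < \<tau>" and \<gamma>: "0 < \<gamma>" and le: "\<And>t. 0 \<le> t \<Longrightarrow> \<bar>f t\<bar> \<le> a (nat \<lfloor>t / \<tau>\<rfloor>)"
    and a: "(\<lambda>n. a n * real (n + 1) powr \<gamma>) \<longlonglongrightarrow> 0"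
  shows "f \<in> o[at_top](\<lambda>t. t powr (- \<gamma>))"
proof (rule smalloI_tendsto)
  have "((\<lambda>t. f t * t powr \<gamma>) \<longlongrightarrow> 0) at_top"
  proof (rule tendsto_0_if_sampled[OF \<tau>])
    show "(\<lambda>n. \<tau> powr \<gamma> * (a n * real (n + 1) powr \<gamma>)) \<longlonglongrightarrow> 0"
      by (rule tendsto_mult_right_zero[OF a])
    fix t :: real assume t: "0 \<le> t"
    let ?n = "nat \<lfloor>t / \<tau>\<rfloor>"
    have "t / \<tau> \<le> real (?n + 1)" using less_Suc_nat_floor[of "t / \<tau>"] t \<tau> by simp
    then have "t \<le> \<tau> * real (?n + 1)" using \<tau> by (simp add: field_simps)
    then have "t powr \<gamma> \<le> \<tau> powr \<gamma> * real (?n + 1) powr \<gamma>"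
      using powr_mono2[of \<gamma> t "\<tau> * real (?n + 1)"] t \<tau> \<gamma> by (simp add: powr_mult)
    then have "\<bar>f t\<bar> * t powr \<gamma> \<le> a ?n * (\<tau> powr \<gamma> * real (?n + 1) powr \<gamma>)"
      using le[OF t] by (intro mult_mono) auto
    then show "\<bar>f t * t powr \<gamma>\<bar> \<le> \<tau> powr \<gamma> * (a ?n * real (?n + 1) powr \<gamma>)"
      by (simp add: abs_mult mult_ac)
  qed
  moreover have "\<forall>\<^sub>F t in at_top. f t * t powr \<gamma> = f t / t powr (- \<gamma>)"
    using eventually_gt_at_top[of 0] by eventually_elim (simp add: powr_minus divide_inverse)
  ultimately show "((\<lambda>t. f t / t powr (- \<gamma>)) \<longlongrightarrow> 0) at_top" by (rule Lim_transform_eventually)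
  show "\<forall>\<^sub>F t in at_top. t powr (- \<gamma>) \<noteq> 0"
    using eventually_gt_at_top[of 0] by eventually_elim simp
qed

text \<open>
  Write \<open>t\<close> as \<open>n\<close> full periods plus a remainder; the motion during the remainder is a contraction.
\<close>
lemma evolution_family_contracts_sampled:
  fixes U :: "real \<Rightarrow> 'a::real_normed_vector \<Rightarrow> 'a"
  assumes shift: "\<And>x t. 0 \<le> t \<Longrightarrow> U (t + \<tau>) x = U t (T x)"
    and contr: "\<And>t x. 0 \<le> t \<Longrightarrow> norm (U t x) \<le> norm x"
    and "0 < \<tau>" "0 \<le> t"
  shows "norm (U t x) \<le> norm ((T ^^ nat \<lfloor>t / \<tau>\<rfloor>) x)"
proof -
  have iter: "U (s + real n * \<tau>) x = U s ((T ^^ n) x)" if "0 \<le> s" for s n x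
  proof (induction n arbitrary: x)
    case (Suc n)
    have "U (s + real (Suc n) * \<tau>) x = U ((s + real n * \<tau>) + \<tau>) x" by (simp add: algebra_simps)
    also have "\<dots> = U (s + real n * \<tau>) (T x)" using that \<open>0 < \<tau>\<close> by (intro shift) simp
    also have "\<dots> = U s ((T ^^ n) (T x))" by (rule Suc)
    finally show ?case by (simp add: funpow_swap1)
  qed simp
  define n where "n = nat \<lfloor>t / \<tau>\<rfloor>"
  have "real n \<le> t / \<tau>" using assms(3,4) by (simp add: n_def)
  then have s: "0 \<le> t - real n * \<tau>" using \<open>0 < \<tau>\<close> by (simp add: field_simps)
  have "U t x = U (t - real n * \<tau>) ((T ^^ n) x)" using iter[OF s, of n x] by simp
  then show ?thesis using contr[OF s] by (simp add: n_def)
qed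

section \<open>Asymptotics of the damped system\<close>

theorem theorem3p7:
  fixes A0 :: "('x::complex_hilbert \<times> 'x) set"
    and T0 :: "real \<Rightarrow> 'x \<Rightarrow>\<^sub>L 'x"
    and B :: "real \<Rightarrow> 'v::complex_hilbert \<Rightarrow>\<^sub>L 'x"
    and U :: "real \<Rightarrow> real \<Rightarrow> 'x \<Rightarrow>\<^sub>L 'x"
    and T :: "'x \<Rightarrow>\<^sub>L 'x"
    and P :: "'x \<Rightarrow> 'x"
    and Y Z :: "'x set"
    and \<tau> :: real
  assumes "unitary_group T0" and "A0 = generator T0"
    and "\<And>t. t \<ge> 0 \<Longrightarrow> clinear (B t)" and "L2_loc B"
    and "contraction_family_of T0 B U"
    and "\<tau> > 0" and "AE t in lebesgue_on {0..}. B (t + \<tau>) = B t"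
    and "T0 \<tau> = id_blinfun"
    and T_def: "T = U \<tau> 0"
    and Y_def: "Y = {x. observed_energy B T0 \<tau> x = 0}"
    and P_def: "P = orth_projection Y"
    and Z_def: "Z = orth_complement Y"
  shows
    "((\<forall>x. ((\<lambda>t. norm (U t 0 x - U t 0 (P x))) \<longlongrightarrow> 0) at_top \<and>
           periodic_with \<tau> (\<lambda>t. U t 0 (P x))) \<and>
      asymptotically_periodic U \<and>
      (stable U \<longleftrightarrow> approx_observable B T0 \<tau> UNIV)) \<and>
     ((\<exists>M>0. \<exists>\<beta>>0. \<forall>t\<ge>0. \<forall>x. norm (U t 0 x - U t 0 (P x)) \<le> M * exp (- \<beta> * t) * norm x) \<longleftrightarrow>
      exactly_observable B T0 \<tau> Z) \<and>
     (\<forall>x. \<forall>\<gamma>>0. x - P x \<in> range (frac_power (id_blinfun - T) \<gamma>) \<longrightarrow>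
        (\<lambda>t. norm (U t 0 x - U t 0 (P x))) \<in> o[at_top](\<lambda>t. t powr (- \<gamma>))) \<and>
     (\<exists>X0. csubspace X0 \<and> closure X0 = UNIV \<and>
        (\<forall>x\<in>X0. \<forall>\<gamma>>0. (\<lambda>t. norm (U t 0 x - U t 0 (P x))) \<in> o[at_top](\<lambda>t. t powr (- \<gamma>))))"
proof -
  have evo: "evolution_family U" and contr: "\<And>s t. 0 \<le> s \<Longrightarrow> s \<le> t \<Longrightarrow> norm (U t s) \<le> 1"
    and mild: "\<And>x t. 0 \<le> t \<Longrightarrow> ((\<lambda>s. T0 (t - s) (B s (cadjoint (B s) (U s 0 x))))
        has_integral (T0 t x - U t 0 x)) {0..t}"
    using assms(5) unfolding contraction_family_of_def by blast+
  interpret D: damped_rotation T0 "\<lambda>t. cadjoint (B t)" "\<lambda>t. (norm (B t))\<^sup>2" \<tau>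
    by (rule damped_rotation_of_contraction_family) fact+
  have weak: "D.weak_solution x (\<lambda>t. U t 0 x)" for x
  proof (rule D.weak_solution_if_mild[where B = B])
    have "continuous_on {(t, s). 0 \<le> s \<and> s \<le> t} (\<lambda>(t, s). U t s x)"
      using evo by (simp add: evolution_family_def)
    then have "continuous_on {0..} ((\<lambda>(t, s). U t s x) \<circ> (\<lambda>t::real. (t, 0)))"
      by (rule continuous_on_compose[rotated, OF continuous_on_subset]) (auto intro!: continuous_intros)
    then show "continuous_on {0..} (\<lambda>t. U t 0 x)" by (simp add: comp_def)
    show "B s u \<bullet> y = u \<bullet> cadjoint (B s) y" if "0 \<le> s" for s u y
      using assms(3)[OF that] by (simp add: cadjoint_eq_real_adjoint real_adjoint)
  qed (rule mild)
  have shift: "U (t + \<tau>) 0 x = U t 0 (T x)" if "0 \<le> t" for t x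
    using D.weak_solution_unique[OF D.weak_solution_shift[OF weak] weak that] by (simp add: T_def)
  define K where "K = 1 + D.beta_mass\<^sup>2"
  have energy: "observed_energy B T0 \<tau> x = D.energy x" for x
    by (simp add: observed_energy_def D.energy_def)
  interpret S: dissipative_contraction T D.energy K
  proof
    fix x y
    show "0 \<le> D.energy x" by (rule D.energy_nonneg)
    show "0 < K" by (simp add: K_def add_pos_nonneg)
    show "D.energy x \<le> K * ((norm x)\<^sup>2 - (norm (T x))\<^sup>2)"
      unfolding K_def T_def by (rule D.energy_le_dissipation[OF weak])
    show "((x - T x) \<bullet> y)\<^sup>2 \<le> D.energy x * D.energy y"
      unfolding T_def by (rule D.monodromy_form_bound[OF weak])
  qed
  have Y: "Y = S.Fix" by (auto simp: Y_def energy S.q_eq_0_iff S.Fix_def)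
  have "clinear T" using evo \<open>\<tau> > 0\<close> by (simp add: evolution_family_def T_def)
  then have T_scaleC: "T (c *\<^sub>C x) = c *\<^sub>C T x" for c x by (simp add: clinear_def)
  have Fix_scaleC: "c *\<^sub>C y \<in> S.Fix" if "y \<in> S.Fix" for c y
    using that T_scaleC by (simp add: S.Fix_def)
  have Z: "Z = S.Fix_perp"
    unfolding Z_def Y S.Fix_perp_def by (rule orth_complement_eq_real) (rule Fix_scaleC)
  have P_eq: "P x = p" if "p \<in> S.Fix" "x - p \<in> S.Fix_perp" for x p
    unfolding P_def orth_projection_def
  proof (rule the_equality)
    show "p \<in> Y \<and> x - p \<in> orth_complement Y" using that Z Z_def Y by simp
    fix p' assume "p' \<in> Y \<and> x - p' \<in> orth_complement Y"
    then have p': "p' \<in> S.Fix" "x - p' \<in> S.Fix_perp" using Z Z_def Y by simp_all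
    have "p' - p \<in> S.Fix" using p'(1) that(1) S.subspace_Fix by (simp add: subspace_diff)
    then have "(x - p) \<bullet> (p' - p) = 0" "(x - p') \<bullet> (p' - p) = 0"
      using p'(2) that(2) by (simp_all add: S.Fix_perp_def)
    then have "(p' - p) \<bullet> (p' - p) = 0" by (simp add: inner_diff_left)
    then show "p' = p" by simp
  qed
  have P: "P x \<in> S.Fix" "x - P x \<in> S.Fix_perp" for x
    using S.Fix_decomposition[of x] P_eq by auto
  have sampled: "norm (U t 0 w) \<le> norm (S.Tpow (nat \<lfloor>t / \<tau>\<rfloor>) w)" if "0 \<le> t" for t w
  proof (rule evolution_family_contracts_sampled[where U = "\<lambda>t. blinfun_apply (U t 0)"])
    show "norm (U t 0 x) \<le> norm x" if "0 \<le> t" for t x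
      using order_trans[OF norm_blinfun mult_right_mono[OF contr[OF _ that] norm_ge_zero]] by simp
  qed (use shift \<open>\<tau> > 0\<close> that in auto)
  have sampled_diff: "\<bar>norm (U t 0 x - U t 0 (P x))\<bar> \<le> norm (S.Tpow (nat \<lfloor>t / \<tau>\<rfloor>) (x - P x))"
    if "0 \<le> t" for t x
    using sampled[OF that, of "x - P x"] by (simp add: blinfun.diff_right)
  have rate: "(\<lambda>t. norm (U t 0 x - U t 0 (P x))) \<in> o[at_top](\<lambda>t. t powr (- \<gamma>))"
    if "0 < \<gamma>" "(\<lambda>n. norm (S.Tpow n (x - P x)) * real (n + 1) powr \<gamma>) \<longlonglongrightarrow> 0" for x \<gamma>
    by (rule smallo_powr_if_sampled[OF \<open>\<tau> > 0\<close> that(1) sampled_diff that(2)])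
  have conv: "((\<lambda>t. norm (U t 0 x - U t 0 (P x))) \<longlongrightarrow> 0) at_top" for x
    by (rule tendsto_0_if_sampled[OF \<open>\<tau> > 0\<close> sampled_diff tendsto_norm_zero[OF S.Tpow_tendsto_0[OF P(2)]]])
  have periodic: "periodic_with \<tau> (\<lambda>t. U t 0 (P x))" for x
    using P(1)[of x] by (simp add: periodic_with_def shift S.Fix_def)
  have U_iterate: "U (real n * \<tau>) 0 x = S.Tpow n x" for n x
  proof (induction n arbitrary: x)
    case 0 show ?case using evo by (simp add: evolution_family_def)
  next
    case (Suc n)
    have "U (real (Suc n) * \<tau>) 0 x = U (real n * \<tau> + \<tau>) 0 x" by (simp add: algebra_simps)
    also have "\<dots> = S.Tpow n (T x)" using \<open>\<tau> > 0\<close> by (simp add: shift Suc)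
    finally show ?case by (simp add: funpow_swap1)
  qed
  have asym: "asymptotically_periodic U"
    unfolding asymptotically_periodic_def using conv periodic \<open>\<tau> > 0\<close> by blast
  have stability: "stable U \<longleftrightarrow> approx_observable B T0 \<tau> UNIV"
  proof
    assume st: "stable U"
    have "y = 0" if "y \<in> S.Fix" for y
    proof -
      have st_y: "((\<lambda>t. norm (U t 0 y)) \<longlongrightarrow> 0) at_top" using st by (simp add: stable_def)
      have "filterlim (\<lambda>n. real n * \<tau>) at_top sequentially"
        using \<open>\<tau> > 0\<close> by (intro filterlim_at_top_mult_tendsto_pos[OF tendsto_const _ filterlim_real_sequentially])
      then have "(\<lambda>n. norm (U (real n * \<tau>) 0 y)) \<longlonglongrightarrow> 0"
        by (rule filterlim_compose[OF st_y])
      moreover have "S.Tpow n y = y" for n using that by (induction n) (simp_all add: S.Fix_def)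
      ultimately show ?thesis by (simp add: U_iterate LIMSEQ_const_iff)
    qed
    then show "approx_observable B T0 \<tau> UNIV"
      by (simp add: approx_observable_def energy S.q_eq_0_iff S.Fix_def)
  next
    assume "approx_observable B T0 \<tau> UNIV"
    then have "P x = 0" for x
      using P(1)[of x] by (simp add: approx_observable_def energy S.q_eq_0_iff S.Fix_def)
    then show "stable U" using conv by (simp add: stable_def)
  qed
  have exponential: "(\<exists>M>0. \<exists>\<beta>>0. \<forall>t\<ge>0. \<forall>x. norm (U t 0 x - U t 0 (P x)) \<le> M * exp (- \<beta> * t) * norm x)
      \<longleftrightarrow> exactly_observable B T0 \<tau> Z"
  proof
    assume "\<exists>M>0. \<exists>\<beta>>0. \<forall>t\<ge>0. \<forall>x. norm (U t 0 x - U t 0 (P x)) \<le> M * exp (- \<beta> * t) * norm x"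
    then obtain M \<beta> where M: "M > 0" and \<beta>: "\<beta> > 0"
      and le: "\<And>t x. t \<ge> 0 \<Longrightarrow> norm (U t 0 x - U t 0 (P x)) \<le> M * exp (- \<beta> * t) * norm x" by blast
    \<comment> \<open>After this many periods the factor \<open>M * exp (- \<beta> * t)\<close> has fallen below one half.\<close>
    obtain n where n: "ln (2 * M) / (\<beta> * \<tau>) < real n" using reals_Archimedean2 by blast
    then have "ln (2 * M) < \<beta> * (real n * \<tau>)" using \<beta> \<open>\<tau> > 0\<close> by (simp add: field_simps)
    then have "2 * M \<le> exp (\<beta> * (real n * \<tau>))" using M by (metis exp_le_cancel_iff exp_ln less_imp_le mult_pos_pos zero_less_numeral)
    then have half: "M * exp (- \<beta> * (real n * \<tau>)) \<le> 1 / 2" by (simp add: exp_minus field_simps)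
    have "norm (S.Tpow n w) \<le> norm w / 2" if w: "w \<in> S.Fix_perp" for w
    proof -
      have "P w = 0" by (rule P_eq) (use w in \<open>simp_all add: S.Fix_def\<close>)
      then have "norm (S.Tpow n w) \<le> M * exp (- \<beta> * (real n * \<tau>)) * norm w"
        using le[of "real n * \<tau>" w] \<open>\<tau> > 0\<close> by (simp add: U_iterate)
      also have "\<dots> \<le> 1 / 2 * norm w" using half by (intro mult_right_mono) auto
      finally show ?thesis by simp
    qed
    from S.coercive_if_power_contracts[OF this]
    show "exactly_observable B T0 \<tau> Z" by (simp add: exactly_observable_def Z energy)
  next
    assume "exactly_observable B T0 \<tau> Z"
    then obtain \<kappa> where "0 < \<kappa>" "\<And>w. w \<in> S.Fix_perp \<Longrightarrow> \<kappa>\<^sup>2 * (norm w)\<^sup>2 \<le> D.energy w"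
      by (auto simp: exactly_observable_def Z energy)
    from S.Tpow_geometric_if_coercive[OF this] obtain \<rho> where \<rho>: "0 < \<rho>" "\<rho> < 1"
      and geo: "\<And>n w. w \<in> S.Fix_perp \<Longrightarrow> norm (S.Tpow n w) \<le> \<rho> ^ n * norm w" by blast
    define \<beta> where "\<beta> = - ln \<rho> / \<tau>"
    have "norm (U t 0 x - U t 0 (P x)) \<le> 1 / \<rho> * exp (- \<beta> * t) * norm x" if t: "0 \<le> t" for t x
    proof -
      define n where "n = nat \<lfloor>t / \<tau>\<rfloor>"
      have "norm (U t 0 x - U t 0 (P x)) \<le> \<rho> ^ n * norm (x - P x)"
        using sampled_diff[OF t, of x] geo[OF P(2)[of x], of n] by (simp add: n_def)
      also have "\<dots> \<le> (1 / \<rho> * exp (- \<beta> * t)) * norm x"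
      proof (rule mult_mono)
        \<comment> \<open>The incomplete last period is charged to the constant \<open>1 / \<rho>\<close>.\<close>
        have "\<rho> ^ n = 1 / \<rho> * \<rho> ^ (n + 1)" using \<rho>(1) by simp
        also have "\<rho> ^ (n + 1) = exp (ln \<rho> * real (n + 1))"
          using \<rho>(1) exp_of_nat_mult[of "n + 1" "ln \<rho>"] by (simp add: mult.commute)
        also have "\<dots> \<le> exp (ln \<rho> * (t / \<tau>))"
        proof -
          have "t / \<tau> \<le> real (n + 1)"
            unfolding n_def using less_Suc_nat_floor[of "t / \<tau>"] t \<open>\<tau> > 0\<close> by simp
          then have "ln \<rho> * real (n + 1) \<le> ln \<rho> * (t / \<tau>)"
            by (rule mult_left_mono_neg) (use \<rho> in simp)
          then show ?thesis by simp
        qed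
        finally show "\<rho> ^ n \<le> 1 / \<rho> * exp (- \<beta> * t)" using \<rho>(1) by (simp add: \<beta>_def divide_right_mono)
        have "(x - P x) \<bullet> P x = 0" using P[of x] by (simp add: S.Fix_perp_def)
        then have "(norm (x - P x))\<^sup>2 + (norm (P x))\<^sup>2 = (norm x)\<^sup>2"
          by (simp add: power2_norm_eq_inner inner_diff_left inner_diff_right inner_commute)
        then have "(norm (x - P x))\<^sup>2 \<le> (norm x)\<^sup>2" by (metis le_add_same_cancel1 zero_le_power2)
        then show "norm (x - P x) \<le> norm x" by (rule power2_le_imp_le) simp
      qed (use \<rho> in auto)
      finally show ?thesis .
    qed
    moreover have "\<beta> > 0" using \<rho> \<open>\<tau> > 0\<close> by (simp add: \<beta>_def divide_neg_pos)
    ultimately show "\<exists>M>0. \<exists>\<beta>>0. \<forall>t\<ge>0. \<forall>x. norm (U t 0 x - U t 0 (P x)) \<le> M * exp (- \<beta> * t) * norm x"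
      using \<rho>(1) by (intro exI[of _ "1 / \<rho>"] conjI exI[of _ \<beta>]) auto
  qed
  have fractional: "(\<lambda>t. norm (U t 0 x - U t 0 (P x))) \<in> o[at_top](\<lambda>t. t powr (- \<gamma>))"
    if \<gamma>: "0 < \<gamma>" and range: "x - P x \<in> range (frac_power (id_blinfun - T) \<gamma>)" for x \<gamma>
  proof -
    obtain u where u: "x - P x = frac_power S.S \<gamma> u" using range by blast
    show ?thesis
      by (rule rate[OF \<gamma>], rule S.Tpow_frac_power_decay[OF \<gamma>, where u = u and c = "sin (pi * frac \<gamma>) / pi"])
         (simp only: u frac_power_def frac_power_aux_def S.balakrishnan_def)
  qed
  \<comment> \<open>Superpolynomial decay holds as soon as the part outside the fixed space is in the range of every
    power of \<open>S\<close>.\<close>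
  define X0 where "X0 = {x. \<exists>y\<in>S.Fix. \<forall>k. \<exists>v. x - y = S.Spow k v}"
  have S_scaleC: "clinear S.S"
    using T_scaleC by (simp add: clinear_def blinfun.diff_left scaleC_diff_right)
  have "csubspace X0"
    unfolding csubspace_def
  proof (intro conjI ballI allI)
    have "0 - 0 = S.Spow k 0" for k by (induction k) simp_all
    then have "\<forall>k. \<exists>v. 0 - 0 = S.Spow k v" by blast
    then show "0 \<in> X0" unfolding X0_def using subspace_0[OF S.subspace_Fix] by blast
    fix x assume "x \<in> X0"
    then obtain y where y: "y \<in> S.Fix" "\<forall>k. \<exists>v. x - y = S.Spow k v" unfolding X0_def by blast
    then obtain f where x: "y \<in> S.Fix" "\<And>k. x - y = S.Spow k (f k)" by metis
    have "c *\<^sub>C x - c *\<^sub>C y = S.Spow k (c *\<^sub>C f k)" for c k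
    proof -
      have "c *\<^sub>C x - c *\<^sub>C y = c *\<^sub>C (x - y)" by (simp only: scaleC_diff_right)
      then show ?thesis by (simp only: x(2)[of k] funpow_clinear[OF S_scaleC])
    qed
    then show "c *\<^sub>C x \<in> X0" for c unfolding X0_def using Fix_scaleC[OF x(1)] by blast
    fix x' assume "x' \<in> X0"
    then obtain y' where y': "y' \<in> S.Fix" "\<forall>k. \<exists>v. x' - y' = S.Spow k v" unfolding X0_def by blast
    then obtain f' where x': "y' \<in> S.Fix" "\<And>k. x' - y' = S.Spow k (f' k)" by metis
    have "x + x' - (y + y') = S.Spow k (f k + f' k)" for k
    proof -
      interpret s: bounded_linear "S.Spow k" by (rule S.bounded_linear_Spow)
      show ?thesis by (simp add: s.add x(2)[of k, symmetric] x'(2)[of k, symmetric])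
    qed
    then show "x + x' \<in> X0" unfolding X0_def using subspace_add[OF S.subspace_Fix x(1) x'(1)] by blast
  qed
  moreover have "closure X0 = UNIV"
  proof -
    have "\<exists>x'\<in>X0. dist x' x < e" if e: "0 < e" for x e
    proof -
      obtain w where w: "norm (w - (x - P x)) < e" "\<forall>k. \<exists>v. w = S.Spow k v"
        using S.Fix_perp_dense_smooth[OF P(2)[of x] e] by blast
      have "P x + w \<in> X0" unfolding X0_def 
        by (rule CollectI, rule bexI[of _ "P x"]) (use P(1)[of x] w(2) in simp_all)
      moreover have "dist (P x + w) x < e" using w(1) by (simp add: dist_norm algebra_simps)
      ultimately show ?thesis by blast
    qed
    then show ?thesis by (auto simp: closure_approachable)
  qed
  moreover have "(\<lambda>t. norm (U t 0 x - U t 0 (P x))) \<in> o[at_top](\<lambda>t. t powr (- \<gamma>))"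
    if x: "x \<in> X0" and \<gamma>: "0 < \<gamma>" for x \<gamma>
  proof -
    obtain y where y: "y \<in> S.Fix" "\<And>k. \<exists>v. x - y = S.Spow k v" using x unfolding X0_def by blast
    obtain v where "x - y = S.S v" using y(2)[of 1] by auto
    then have "x - y \<in> S.Fix_perp" using S.S_in_Fix_perp[of v] by simp
    then have "P x = y" by (rule P_eq[OF y(1)])
    then show ?thesis using rate[OF \<gamma> S.Tpow_smooth_decay] y(2) by blast
  qed
  ultimately have "\<exists>X0. csubspace X0 \<and> closure X0 = UNIV \<and>
      (\<forall>x\<in>X0. \<forall>\<gamma>>0. (\<lambda>t. norm (U t 0 x - U t 0 (P x))) \<in> o[at_top](\<lambda>t. t powr (- \<gamma>)))" by blast
  then show ?thesis using conv periodic asym stability exponential fractional by blast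
qed

end
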